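(* Let $N\ge 3$ and let $f$ satisfy the standing assumptions given in the context. Let $q_S=\frac{N+2}{4}$ and assume that $$f'(u)F(u)\le q_S\quad\text{for sufficiently large } u.$$ If there exists a singular radial solution $u^*$ of $\Delta u+f(u)=0$ in $\mathbb{R}^N$ satisfying $$u^*(r)>0\ \text{ for all } r>0,\qquad f'(u^*(|\cdot|))\in L^1_{\rm loc}(\mathbb{R}^N),$$ and $$\int_{\mathbb{R}^N}\bigl(|\nabla\phi|^2-f'(u^*(|x|))\phi^2\bigr)\,dx\ge 0\quad\text{for any }\phi\in C^1_0(\mathbb{R}^N),$$ then $u(r,\alpha)$ is stable for every $\alpha>0$, and $u(r,\alpha)$ is strictly increasing in $\alpha>0$ for each fixed $r>0$.
   Context: $N\ge 3$ is an integer. Standing assumptions on $f:\mathbb{R}\to\mathbb{R}$: $f\in C^2(\mathbb{R}\setminus\{0\})\cap C^1(\mathbb{R})$; $f$ is odd (so $f(0)=0$); and for all $u>0$, $f(u)>0$, $f'(u)>0$, $f''(u)>0$ and $F(u):=\int_u^\infty \frac{ds}{f(s)}<\infty$. For $\alpha>0$, $u(r,\alpha)$ denotes the unique solution of $u''+\frac{N-1}{r}u'+f(u)=0$ for $r>0$, $u(0)=\alpha$, $u'(0)=0$. $C^1_0(\mathbb{R}^N)$ denotes $C^1$ functions with compact support. A solution $u\in C^2(\mathbb{R}^N)$ of $\Delta u+f(u)=0$ in $\mathbb{R}^N$ is called stable if $\int_{\mathbb{R}^N}(|\nabla\phi|^2-f'(u)\phi^2)\,dx\ge 0$ for every $\phi\in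 C^1_0(\mathbb{R}^N)$. We say $u(r,\alpha)$ is stable if $x\mapsto u(|x|,\alpha)$ is. A singular radial solution of $\Delta u+f(u)=0$ in $\mathbb{R}^N$ is a function $u^*\in C^2(0,\infty)$ satisfying $(u^* )''+\frac{N-1}{r}(u^* )'+f(u^* )=0$ for $r>0$ and $u^*(r)\to\infty$ as $r\to 0$. *)

theory Defs
  imports "HOL-Analysis.Analysis"
begin

definition C2_differentiable_on :: "(real \<Rightarrow> real) \<Rightarrow> real set \<Rightarrow> bool"
    (infix "C2'_differentiable'_on" 50) where
  "g C2_differentiable_on S \<longleftrightarrow>
     g C1_differentiable_on S \<and> deriv g C1_differentiable_on S"

text \<open>The tail integral $F(u) = \int_u^\infty ds / f(s)$. Its finiteness is a separate
  condition, since the Lebesgue integral of a non-integrable function is 0.\<close>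

definition tail_integral :: "(real \<Rightarrow> real) \<Rightarrow> real \<Rightarrow> real" where
  "tail_integral f u = (LBINT s:{u..}. 1 / f s)"

definition standing_assumptions :: "(real \<Rightarrow> real) \<Rightarrow> bool" where
  "standing_assumptions f \<longleftrightarrow>
     f C2_differentiable_on (- {0}) \<and>
     f C1_differentiable_on UNIV \<and>
     (\<forall>x. f (- x) = - f x) \<and>
     (\<forall>u>0. f u > 0 \<and> deriv f u > 0 \<and> deriv (deriv f) u > 0 \<and>
            set_integrable lborel {u..} (\<lambda>s. 1 / f s))"

text \<open>Functions on the half-line are represented by total functions on the reals;
  only their values at positive (resp. nonnegative) arguments matter.\<close>

definition radial_ode :: "nat \<Rightarrow> (real \<Rightarrow> real) \<Rightarrow> (real \<Rightarrow> real) \<Rightarrow> bool" where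
  "radial_ode N f u \<longleftrightarrow>
     u C2_differentiable_on {0<..} \<and>
     (\<forall>r>0. deriv (deriv u) r + (real N - 1) / r * deriv u r + f (u r) = 0)"

definition regular_radial_solution ::
    "nat \<Rightarrow> (real \<Rightarrow> real) \<Rightarrow> real \<Rightarrow> (real \<Rightarrow> real) \<Rightarrow> bool" where
  "regular_radial_solution N f \<alpha> u \<longleftrightarrow>
     radial_ode N f u \<and> u 0 = \<alpha> \<and>
     (u has_real_derivative 0) (at 0 within {0..})"

definition singular_radial_solution ::
    "nat \<Rightarrow> (real \<Rightarrow> real) \<Rightarrow> (real \<Rightarrow> real) \<Rightarrow> bool" where
  "singular_radial_solution N f u \<longleftrightarrow>
     radial_ode N f u \<and> filterlim u at_top (at_right 0)"

definition partial_derivative ::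
    "'n::finite \<Rightarrow> (real ^ 'n \<Rightarrow> real) \<Rightarrow> real ^ 'n \<Rightarrow> real" where
  "partial_derivative i g x = frechet_derivative g (at x) (axis i 1)"

definition gradient :: "(real ^ 'n::finite \<Rightarrow> real) \<Rightarrow> real ^ 'n \<Rightarrow> real ^ 'n" where
  "gradient g x = (\<chi> i. partial_derivative i g x)"

definition laplacian :: "(real ^ 'n::finite \<Rightarrow> real) \<Rightarrow> real ^ 'n \<Rightarrow> real" where
  "laplacian g x = (\<Sum>i\<in>UNIV. partial_derivative i (partial_derivative i g) x)"

definition C1_function :: "(real ^ 'n::finite \<Rightarrow> real) \<Rightarrow> bool" where
  "C1_function g \<longleftrightarrow>
     (\<forall>x. g differentiable (at x)) \<and>
     (\<forall>i. continuous_on UNIV (partial_derivative i g))"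

definition C2_function :: "(real ^ 'n::finite \<Rightarrow> real) \<Rightarrow> bool" where
  "C2_function g \<longleftrightarrow> C1_function g \<and> (\<forall>i. C1_function (partial_derivative i g))"

definition C1_compact_support :: "(real ^ 'n::finite \<Rightarrow> real) set" where
  "C1_compact_support = {\<phi>. C1_function \<phi> \<and> compact (closure {x. \<phi> x \<noteq> 0})}"

definition L1_loc :: "(real ^ 'n::finite \<Rightarrow> real) set" where
  "L1_loc = {g. \<forall>K. compact K \<longrightarrow> set_integrable lborel K g}"

text \<open>Below, the integrand is integrable whenever \<open>V\<close> is locally integrable, so that
  the Lebesgue integral is not the default value 0.\<close>

definition nonneg_quadratic_form :: "(real ^ 'n::finite \<Rightarrow> real) \<Rightarrow> bool" where
  "nonneg_quadratic_form V \<longleftrightarrow>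
     (\<forall>\<phi>\<in>C1_compact_support.
        (LINT x|lborel. (norm (gradient \<phi> x))\<^sup>2 - V x * (\<phi> x)\<^sup>2) \<ge> 0)"

definition stable_solution :: "(real \<Rightarrow> real) \<Rightarrow> (real ^ 'n::finite \<Rightarrow> real) \<Rightarrow> bool" where
  "stable_solution f w \<longleftrightarrow>
     C2_function w \<and> (\<forall>x. laplacian w x + f (w x) = 0) \<and>
     nonneg_quadratic_form (\<lambda>x. deriv f (w x))"

end

theory Submission
  imports Defs
begin

text \<open>
  Two solutions \<open>0 \<le> v\<^sub>2 < v\<^sub>1 \<le> u\<^sup>*\<close> cannot meet: at a first contact radius \<open>R\<close>, the difference
  \<open>w = v\<^sub>1 - v\<^sub>2\<close> satisfies \<open>- \<Delta>w = f(v\<^sub>1) - f(v\<^sub>2) < f'(u\<^sup>*) w\<close> on the ball of radius \<open>R\<close> by strict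
  convexity, so that \<open>w\<close>, used as a test function, contradicts the stability of \<open>u\<^sup>*\<close>. As \<open>w\<close>
  may be singular at the origin, it is multiplied by the logarithmic cutoff
  \<open>ln (r / a) / ln (R / a)\<close>, and \<open>a\<close> tends to \<open>0\<close>. The error caused by the cutoff vanishes if
  \<open>u\<^sup>*(r) = O(r\<^bsup>-(N-2)/2\<^esup>)\<close>, which is what the growth condition provides: it makes \<open>f F\<^bsup>q\<^esup>\<close>
  nonincreasing for \<open>q = (N + 2) / 4\<close>, hence \<open>F(v) = O(v\<^bsup>-4/(N-2)\<^esup>)\<close>, whereas monotonicity of \<open>u\<^sup>*\<close> gives
  \<open>F(u\<^sup>*(r)) \<ge> r\<^sup>2 / (2N)\<close>. Hence \<open>0 < u(r, \<alpha>) < u\<^sup>*(r)\<close>, and both claims follow.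
\<close>

section \<open>Radial functions and the quadratic form\<close>

text \<open>Polar coordinates for radial integrands, without a surface measure. Both measures give
  \<open>{..a}\<close> the volume of the ball of radius a, because the density is the derivative of
  that volume in the radius, and half-lines form an intersection-stable generator of the Borel
  sets.\<close>

lemma distr_norm_lborel:
  "distr (lborel :: 'a::euclidean_space measure) borel norm =
   density lborel (\<lambda>r. ennreal (real DIM('a) * unit_ball_vol DIM('a) * r ^ (DIM('a) - 1) * indicator {0..} r))"
  (is "?M = ?D")
proof (rule measure_eqI_generator_eq[where \<Omega> = UNIV and E = "range (\<lambda>a::real. {..a})"
      and A = "\<lambda>i. {..real i}"])
  show "Int_stable (range (\<lambda>a::real. {..a}))"
    by (auto simp: Int_stable_def)
  show "sets ?M = sigma_sets UNIV (range (\<lambda>a::real. {..a}))"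
    by (simp add: borel_eq_atMost)
  show "sets ?D = sigma_sets UNIV (range (\<lambda>a::real. {..a}))"
    by (simp add: borel_eq_atMost)
  show "(\<Union>i. {..real i}) = UNIV"
    using real_arch_simple by auto
  have M: "emeasure ?M {..a} = ennreal (unit_ball_vol DIM('a) * a ^ DIM('a))" if "a \<ge> 0" for a
  proof -
    have "emeasure ?M {..a} = emeasure lborel (norm -` {..a} :: 'a set)"
      by (subst emeasure_distr) auto
    also have "norm -` {..a} = cball (0::'a) a"
      by auto
    finally show ?thesis
      using that by (simp add: emeasure_cball)
  qed
  show "emeasure ?M {..real i} \<noteq> \<infinity>" for i
    using M[of "real i"] by simp
  fix X :: "real set"
  assume "X \<in> range (\<lambda>a. {..a})"
  then obtain a where X: "X = {..a}" by auto
  show "emeasure ?M X = emeasure ?D X"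
  proof (cases "a \<ge> 0")
    case True
    have "emeasure ?D X = (\<integral>\<^sup>+r. ennreal (real DIM('a) * unit_ball_vol DIM('a) * r ^ (DIM('a) - 1)) * indicator {0..a} r \<partial>lborel)"
      by (subst emeasure_density) (auto simp: X intro!: nn_integral_cong split: split_indicator)
    \<comment> \<open>The contribution of the lower limit vanishes because the dimension is
      positive.\<close>
    also have "\<dots> = ennreal (unit_ball_vol DIM('a) * a ^ DIM('a) - unit_ball_vol DIM('a) * 0 ^ DIM('a))"
      using True
      by (intro nn_integral_FTC_Icc) (auto intro!: derivative_eq_intros)
    finally show ?thesis
      using M[OF True] by (simp add: X zero_power)
  next
    case False
    have "emeasure ?D X = (\<integral>\<^sup>+r. 0 \<partial>(lborel :: real measure))"
    proof (subst emeasure_density)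
      show "(\<integral>\<^sup>+r\<in>X. ennreal (real DIM('a) * unit_ball_vol DIM('a) * r ^ (DIM('a) - 1) * indicator {0..} r) \<partial>lborel) =
            (\<integral>\<^sup>+r. 0 \<partial>(lborel :: real measure))"
        using False by (intro nn_integral_cong) (auto simp: X split: split_indicator)
    qed (auto simp: X)
    moreover have "norm -` {..a} = ({} :: 'a set)"
      using False order_trans[OF norm_ge_zero] by auto
    ultimately show ?thesis
      by (simp add: X emeasure_distr)
  qed
qed auto

lemma integral_radial:
  fixes q :: "real \<Rightarrow> real"
  assumes ab: "0 \<le> a" and q: "continuous_on {a..b} q" and q0: "\<And>r. r \<notin> {a..b} \<Longrightarrow> q r = 0"
  shows "(LINT x|(lborel :: 'a::euclidean_space measure). q (norm x)) =
         real DIM('a) * unit_ball_vol DIM('a) * integral {a..b} (\<lambda>r. r ^ (DIM('a) - 1) * q r)"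
proof -
  let ?k = "real DIM('a) * unit_ball_vol DIM('a)"
  \<comment> \<open>\<open>q\<close> may jump at \<open>a\<close> and \<open>b\<close>, so
    measurability comes from continuity on the interval together with the indicator.\<close>
  have "q = (\<lambda>r. indicator {a..b} r *\<^sub>R q r)"
    using q0 by (auto simp: fun_eq_iff split: split_indicator)
  moreover have "(\<lambda>r. indicator {a..b} r *\<^sub>R q r) \<in> borel_measurable borel"
    using q by (intro borel_measurable_continuous_on_indicator) auto
  ultimately have meas [measurable]: "q \<in> borel_measurable borel"
    by simp
  have "(LINT x|(lborel :: 'a measure). q (norm x)) = (LINT r|distr (lborel :: 'a measure) borel norm. q r)"
    by (subst integral_distr) auto
  also have "\<dots> = (LINT r|lborel. (?k * r ^ (DIM('a) - 1) * indicator {0..} r) *\<^sub>R q r)"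
    unfolding distr_norm_lborel
    by (subst integral_density) (auto split: split_indicator)
  also have "\<dots> = (LINT r|lborel. ?k * (indicator {a..b} r *\<^sub>R (r ^ (DIM('a) - 1) * q r)))"
    using ab q0 by (intro Bochner_Integration.integral_cong) (auto split: split_indicator)
  also have "\<dots> = ?k * (LINT r:{a..b}|lborel. r ^ (DIM('a) - 1) * q r)"
    by (simp add: set_lebesgue_integral_def)
  also have "(LINT r:{a..b}|lborel. r ^ (DIM('a) - 1) * q r) = integral {a..b} (\<lambda>r. r ^ (DIM('a) - 1) * q r)"
    by (intro set_borel_integral_eq_integral borel_integrable_atLeastAtMost' continuous_intros q)
  finally show ?thesis .
qed

lemma has_derivative_radial:
  fixes x :: "'a::real_inner"
  assumes "x \<noteq> 0" and "(p has_real_derivative p') (at (norm x))"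
  shows "((\<lambda>x. p (norm x)) has_derivative (\<lambda>h. p' * (sgn x \<bullet> h))) (at x)"
  using has_derivative_compose[OF has_derivative_norm[OF assms(1)] assms(2)[unfolded has_field_derivative_def]]
  by (simp add: inner_commute)

lemma partial_derivativeI:
  assumes "(g has_derivative g') (at x)"
  shows "partial_derivative i g x = g' (axis i 1)"
  using frechet_derivative_at[OF assms] by (simp add: partial_derivative_def)

text \<open>The norm is not differentiable at the origin, but \<open>p\<close> vanishes below
  \<open>a\<close>, so the composite is constant near that point.\<close>

lemma C1_compact_support_radial:
  assumes a: "0 < a" and p: "\<And>r. (p has_real_derivative p' r) (at r)" and p': "continuous_on UNIV p'"
    and out: "\<And>r. r \<notin> {a..b} \<Longrightarrow> p r = 0"
  shows "(\<lambda>x :: real ^ 'n::finite. p (norm x)) \<in> C1_compact_support"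
    and "(norm (gradient (\<lambda>x :: real ^ 'n. p (norm x)) x))\<^sup>2 = (p' (norm x))\<^sup>2"
proof -
  have p'0: "p' r = 0" if "r < a" for r
  proof -
    have "(p has_real_derivative 0) (at r)"
      by (rule has_field_derivative_transform_within_open[of "\<lambda>_. 0" _ _ "{..<a}"])
         (use that out in auto)
    with p show ?thesis by (blast intro: DERIV_unique)
  qed
  define G where "G x = p' (norm x) *\<^sub>R sgn x" for x :: "real ^ 'n"
  have der: "((\<lambda>x. p (norm x)) has_derivative (\<lambda>h. G x \<bullet> h)) (at x)" for x :: "real ^ 'n"
  proof (cases "x = 0")
    case True
    have "((\<lambda>x. p (norm x)) has_derivative (\<lambda>h. 0)) (at x)"
      by (rule has_derivative_transform_within_open[of "\<lambda>_. 0" _ _ _ "ball 0 a"])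
         (use a out True in auto)
    with True show ?thesis by (simp add: G_def)
  next
    case False
    from has_derivative_radial[OF this p] show ?thesis by (simp add: G_def)
  qed
  have pd: "partial_derivative i (\<lambda>x. p (norm x)) x = G x $ i" for i and x :: "real ^ 'n"
    using partial_derivativeI[OF der] by (simp add: inner_axis)
  have cont: "continuous_on UNIV G"
  proof -
    \<comment> \<open>Two open sets cover the space: a ball on which \<open>G\<close> is zero, and
      the complement of the origin, where \<open>sgn\<close> is continuous.\<close>
    have 1: "continuous_on (ball 0 a) G"
      by (rule continuous_on_eq[of _ "\<lambda>_. 0"]) (auto simp: G_def p'0)
    have 2: "continuous_on (- {0}) G"
      unfolding G_def sgn_div_norm
      by (intro continuous_intros continuous_on_compose2[OF p']) auto
    have "ball 0 a \<union> - {0} = (UNIV :: (real ^ 'n) set)"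
      using a by auto
    with continuous_on_open_Un[OF _ _ 1 2] show ?thesis by auto
  qed
  show "(norm (gradient (\<lambda>x :: real ^ 'n. p (norm x)) x))\<^sup>2 = (p' (norm x))\<^sup>2"
  proof -
    have "gradient (\<lambda>x. p (norm x)) x = G x"
      by (simp add: gradient_def pd)
    then show ?thesis
      using p'0[of 0] a by (auto simp: G_def norm_sgn)
  qed
  have "{x :: real ^ 'n. p (norm x) \<noteq> 0} \<subseteq> cball 0 b"
    using out by force
  then have "compact (closure {x :: real ^ 'n. p (norm x) \<noteq> 0})"
    by (meson bounded_cball bounded_subset compact_closure)
  moreover have "C1_function (\<lambda>x :: real ^ 'n. p (norm x))"
    unfolding C1_function_def differentiable_def pd
    using der by (auto intro!: continuous_intros cont)
  ultimately show "(\<lambda>x :: real ^ 'n. p (norm x)) \<in> C1_compact_support"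
    by (simp add: C1_compact_support_def)
qed

text \<open>Stability becomes an inequality for functions of one variable with weight r^(N-1).
  Keeping the support in an interval with \<open>0 < a\<close> stays clear of a singularity of
  \<open>V\<close> at the origin.\<close>

lemma radial_quadratic_form_nonneg:
  assumes stab: "nonneg_quadratic_form (\<lambda>x :: real ^ 'n::finite. V (norm x))"
    and V: "continuous_on {a..b} V"
    and a: "0 < a" and p: "\<And>r. (p has_real_derivative p' r) (at r)" and p': "continuous_on UNIV p'"
    and out: "\<And>r. r \<notin> {a..b} \<Longrightarrow> p r = 0" "\<And>r. r \<notin> {a..b} \<Longrightarrow> p' r = 0"
  shows "integral {a..b} (\<lambda>r. r ^ (CARD('n) - 1) * ((p' r)\<^sup>2 - V r * (p r)\<^sup>2)) \<ge> 0"
proof -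
  let ?k = "real CARD('n) * unit_ball_vol CARD('n)"
  have pc: "continuous_on {a..b} p"
    using p by (intro DERIV_continuous_on) (auto intro: has_field_derivative_at_within)
  have p'c: "continuous_on {a..b} p'"
    using p' continuous_on_subset by blast
  have C: "(\<lambda>x :: real ^ 'n. p (norm x)) \<in> C1_compact_support"
      "(norm (gradient (\<lambda>x :: real ^ 'n. p (norm x)) x))\<^sup>2 = (p' (norm x))\<^sup>2" for x :: "real ^ 'n"
    by (rule C1_compact_support_radial[OF a p p' out(1)]; assumption)+
  have "0 \<le> (LINT x|lborel. (norm (gradient (\<lambda>x :: real ^ 'n. p (norm x)) x))\<^sup>2 - V (norm x) * (p (norm x))\<^sup>2)"
    using stab C(1) unfolding nonneg_quadratic_form_def by auto
  also have "\<dots> = (LINT x|(lborel :: (real ^ 'n) measure). (\<lambda>r. (p' r)\<^sup>2 - V r * (p r)\<^sup>2) (norm x))"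
    unfolding C(2) by (rule refl)
  also have "\<dots> = ?k * integral {a..b} (\<lambda>r. r ^ (CARD('n) - 1) * ((p' r)\<^sup>2 - V r * (p r)\<^sup>2))"
    using a out by (subst integral_radial[of a b]) (auto intro!: continuous_intros pc p'c V)
  finally have "0 \<le> ?k * integral {a..b} (\<lambda>r. r ^ (CARD('n) - 1) * ((p' r)\<^sup>2 - V r * (p r)\<^sup>2))" .
  moreover have "?k > 0"
    by (simp add: zero_less_card_finite)
  ultimately show ?thesis
    by (simp add: zero_le_mult_iff)
qed

section \<open>Regular radial solutions\<close>

lemma C1_differentiable_on_derivD:
  fixes g :: "real \<Rightarrow> real"
  assumes "g C1_differentiable_on S"
  shows "x \<in> S \<Longrightarrow> (g has_real_derivative deriv g x) (at x)" and "continuous_on S (deriv g)"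
proof -
  obtain D where D: "\<And>x. x \<in> S \<Longrightarrow> (g has_real_derivative D x) (at x)" "continuous_on S D"
    using assms by (auto simp: C1_differentiable_on_def has_real_derivative_iff_has_vector_derivative)
  then have "deriv g x = D x" if "x \<in> S" for x
    using that by (blast intro: DERIV_imp_deriv)
  with D show "x \<in> S \<Longrightarrow> (g has_real_derivative deriv g x) (at x)" and "continuous_on S (deriv g)"
    by (auto cong: continuous_on_cong)
qed

lemma radial_odeD:
  assumes "radial_ode N f u"
  shows "r > 0 \<Longrightarrow> (u has_real_derivative deriv u r) (at r)"
    and "r > 0 \<Longrightarrow> (deriv u has_real_derivative deriv (deriv u) r) (at r)"
    and "continuous_on {0<..} u" and "continuous_on {0<..} (deriv u)"
    and "r > 0 \<Longrightarrow> deriv (deriv u) r = - ((real N - 1) / r * deriv u r) - f (u r)"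
proof -
  have C1: "u C1_differentiable_on {0<..}" "deriv u C1_differentiable_on {0<..}"
    using assms by (auto simp: radial_ode_def C2_differentiable_on_def)
  from C1_differentiable_on_derivD[OF C1(1)] C1_differentiable_on_derivD[OF C1(2)]
  show "r > 0 \<Longrightarrow> (u has_real_derivative deriv u r) (at r)"
    and "r > 0 \<Longrightarrow> (deriv u has_real_derivative deriv (deriv u) r) (at r)"
    and "continuous_on {0<..} (deriv u)"
    by auto
  show "continuous_on {0<..} u"
    using C1(1) C1_differentiable_imp_continuous_on by blast
  show "deriv (deriv u) r = - ((real N - 1) / r * deriv u r) - f (u r)" if "r > 0"
  proof -
    have "deriv (deriv u) r + (real N - 1) / r * deriv u r + f (u r) = 0"
      using assms that by (simp add: radial_ode_def)
    then show ?thesis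
      by linarith
  qed
qed

text \<open>The divergence form of the equation: the factor r^(N-1) absorbs the first-order term.
  All later comparisons integrate this flux.\<close>

lemma radial_flux_derivative:
  assumes "radial_ode N f u" "N \<ge> 2" "r > 0"
  shows "((\<lambda>r. r ^ (N - 1) * deriv u r) has_real_derivative - (r ^ (N - 1) * f (u r))) (at r)"
proof -
  have "((\<lambda>r. r ^ (N - 1) * deriv u r) has_real_derivative
         (real (N - 1) * r ^ (N - 1 - 1)) * deriv u r + deriv (deriv u) r * r ^ (N - 1)) (at r)"
    by (rule derivative_eq_intros refl radial_odeD(2)[OF assms(1,3)])+ simp
  also have "r ^ (N - 1) = r * r ^ (N - 1 - 1)"
    using assms(2) by (metis Suc_diff_le Suc_1 diff_Suc_Suc diff_zero numeral_2_eq_2 power_Suc One_nat_def)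
  then have "(real (N - 1) * r ^ (N - 1 - 1)) * deriv u r + deriv (deriv u) r * r ^ (N - 1) =
             - (r ^ (N - 1) * f (u r))"
    using assms by (simp add: radial_odeD(5)[OF assms(1)] of_nat_diff field_simps)
  finally show ?thesis .
qed

text \<open>Replaces a limit at the origin: smallness of \<open>z\<close> is asked only along points
  accumulating at 0, which is all that is known beforehand about the flux of a solution.\<close>

lemma nonincreasing_from_origin_nonpos:
  fixes z :: "real \<Rightarrow> real"
  assumes "r > 0" and "\<And>s. 0 < s \<Longrightarrow> s \<le> r \<Longrightarrow> (z has_real_derivative z' s) (at s)"
    and "\<And>s. 0 < s \<Longrightarrow> s \<le> r \<Longrightarrow> z' s \<le> 0"
    and small: "\<And>e. e > 0 \<Longrightarrow> \<exists>s. 0 < s \<and> s < e \<and> z s \<le> e"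
  shows "z r \<le> 0"
proof (rule field_le_epsilon)
  fix e :: real assume "e > 0"
  with small[of "min e r"] \<open>r > 0\<close> obtain s where s: "0 < s" "s < r" "z s \<le> e"
    by auto
  have "z r \<le> z s"
  proof (rule DERIV_nonpos_imp_nonincreasing[of s r z])
    show "\<exists>y. (z has_real_derivative y) (at t) \<and> y \<le> 0" if "s \<le> t" "t \<le> r" for t
      using assms(2,3)[of t] s that by auto
  qed (use s in simp)
  with s show "z r \<le> 0 + e" by simp
qed

text \<open>The limit is the second derivative at the origin and is what makes the lifted solution
  C2 there. The flux has derivative -r^(N-1) f(u) with f(u) close to c = f(u(0)), so it is close to
  -c r^N / N; division by r^N gives the claim.\<close>

lemma regular_radial_deriv_over_r:
  assumes ode: "radial_ode N f u" and N: "N \<ge> 2" and u0: "(u has_real_derivative 0) (at 0 within {0..})"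
    and f: "isCont f (u 0)"
  shows "((\<lambda>r. deriv u r / r) \<longlongrightarrow> - f (u 0) / real N) (at_right 0)"
proof -
  define c where "c = f (u 0)"
  define v where "v r = r ^ (N - 1) * deriv u r" for r
  have vd: "(v has_real_derivative - (r ^ (N - 1) * f (u r))) (at r)" if "r > 0" for r
    using radial_flux_derivative[OF ode N that] by (simp add: v_def[abs_def])
  note D = radial_odeD[OF ode]
  have q0: "((\<lambda>r. (u r - u 0) / r) \<longlongrightarrow> 0) (at_right 0)"
  proof -
    have "((\<lambda>r. (u r - u 0) / r) \<longlongrightarrow> 0) (at 0 within {0..})"
      using u0 by (simp add: has_field_derivative_iff)
    then show ?thesis by (rule tendsto_within_subset) auto
  qed
  have cont0: "(u \<longlongrightarrow> u 0) (at_right 0)"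
  proof -
    have "(u \<longlongrightarrow> u 0) (at 0 within {0..})"
      using DERIV_continuous[OF u0] by (simp add: continuous_within)
    then show ?thesis by (rule tendsto_within_subset) auto
  qed
  \<comment> \<open>The initial condition controls difference quotients and gives no bound on u'
    near 0. The mean value theorem yields points arbitrarily close to 0 where u' is bounded, and the
    flux is small at those points.\<close>
  have small: "\<exists>s. 0 < s \<and> s < e \<and> \<bar>deriv u s\<bar> \<le> 1" if "e > 0" for e
  proof -
    have "eventually (\<lambda>r. dist ((u r - u 0) / r) 0 < 1) (at_right 0)"
      using q0 by (rule tendstoD) simp
    moreover have "eventually (\<lambda>r. r \<in> {0<..<e}) (at_right 0)"
      using that by (rule eventually_at_right_real)
    ultimately have "eventually (\<lambda>r. r \<in> {0<..<e} \<and> \<bar>(u r - u 0) / r\<bar> < 1) (at_right 0)"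
      by eventually_elim auto
    then obtain t where t: "t \<in> {0<..<e}" "\<bar>(u t - u 0) / t\<bar> < 1"
      using eventually_happens trivial_limit_at_right_real by blast
    have "continuous_on {0..t} u"
    proof (unfold continuous_on_eq_continuous_within, rule ballI)
      fix x assume x: "x \<in> {0..t}"
      show "continuous (at x within {0..t}) u"
      proof (cases "x = 0")
        case True
        then show ?thesis
          using DERIV_continuous[OF u0] by (auto intro: continuous_within_subset)
      next
        case False
        with x D(1)[of x] show ?thesis
          by (auto intro: DERIV_isCont continuous_at_imp_continuous_at_within)
      qed
    qed
    moreover have "u differentiable (at x)" if "0 < x" "x < t" for x
      using D(1)[OF that(1)] by (auto simp: real_differentiable_def)
    ultimately obtain l s where s: "0 < s" "s < t" "(u has_real_derivative l) (at s)" "u t - u 0 = (t - 0) * l"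
      using MVT[of 0 t u] t by auto
    then have "deriv u s = (u t - u 0) / t"
      using t by (auto simp: DERIV_imp_deriv)
    with s t show ?thesis by (intro exI[of _ s]) auto
  qed
  \<comment> \<open>The sign \<open>sg\<close> treats the upper and the lower estimate at
    once.\<close>
  have bound: "sg * (deriv u r / r + c / real N) \<le> e"
    if e: "e > 0" and r: "r > 0" and sg: "sg = 1 \<or> sg = -1"
      and close: "\<And>s. 0 < s \<Longrightarrow> s \<le> r \<Longrightarrow> \<bar>f (u s) - c\<bar> \<le> e" for e r sg :: real
  proof -
    define C E where "C = c / real N" and "E = e / real N"
    have CE: "C * real N = c" "E * real N = e" "\<bar>C\<bar> \<le> \<bar>c\<bar>" "E > 0"
      using N e by (auto simp: C_def E_def divide_le_eq mult_le_cancel_left1)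
    \<comment> \<open>The signed deviation of the flux from -C s^N, minus the tolerated error. Its
      derivative s^(N-1) (sg (c - f(u)) - e) is nonpositive while f(u) is within \<open>e\<close> of
      \<open>c\<close>.\<close>
    define z where "z s = sg * (v s + C * s ^ N) - E * s ^ N" for s
    have "z r \<le> 0"
    proof (rule nonincreasing_from_origin_nonpos[OF r])
      fix s assume s: "0 < s" "s \<le> r"
      have "(z has_real_derivative
          sg * (- (s ^ (N - 1) * f (u s)) + C * (real N * s ^ (N - 1))) - E * (real N * s ^ (N - 1))) (at s)"
        unfolding z_def by (auto intro!: derivative_eq_intros vd s)
      also have "sg * (- (s ^ (N - 1) * f (u s)) + C * (real N * s ^ (N - 1))) - E * (real N * s ^ (N - 1)) =
          s ^ (N - 1) * (sg * (C * real N - f (u s)) - E * real N)"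
        by (simp add: algebra_simps)
      finally show "(z has_real_derivative s ^ (N - 1) * (sg * (c - f (u s)) - e)) (at s)"
        by (simp add: CE)
      show "s ^ (N - 1) * (sg * (c - f (u s)) - e) \<le> 0"
        using close[OF s] sg s(1) by (intro mult_nonneg_nonpos) auto
    next
      fix \<eta> :: real assume "\<eta> > 0"
      \<comment> \<open>At a point s < 1 with |u'| \<le> 1, the flux is at most s and the correction
        at most |c| s in absolute value, so z is at most k s.\<close>
      define k where "k = 1 + \<bar>c\<bar>"
      have k: "k \<ge> 1" by (simp add: k_def)
      obtain s where s: "0 < s" "s < min 1 (\<eta> / k)" "\<bar>deriv u s\<bar> \<le> 1"
        using small[of "min 1 (\<eta> / k)"] \<open>\<eta> > 0\<close> k by auto
      have pw: "s ^ (N - 1) \<le> s" "s ^ N \<le> s"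
        using s N power_decreasing[of 1 "N - 1" s] power_decreasing[of 1 N s] by auto
      have 1: "\<bar>v s\<bar> \<le> s"
        using mult_mono[OF pw(1) s(3)] s(1) by (simp add: abs_mult v_def)
      have 2: "\<bar>C * s ^ N\<bar> \<le> \<bar>c\<bar> * s"
        using mult_mono[OF CE(3) pw(2)] s(1) by (simp add: abs_mult)
      have 3: "0 \<le> E * s ^ N"
        using CE s(1) by simp
      have "z s \<le> s + \<bar>c\<bar> * s"
        using sg
      proof
        assume "sg = 1"
        with 1 2 3 show ?thesis unfolding z_def \<open>sg = 1\<close> mult_1 by linarith
      next
        assume "sg = -1"
        with 1 2 3 show ?thesis unfolding z_def \<open>sg = -1\<close> mult_minus1 by linarith
      qed
      also have "\<dots> = s * k"
        by (simp add: k_def algebra_simps)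
      also have "\<dots> < \<eta>"
        using s(2) k by (simp add: pos_less_divide_eq)
      finally have "z s \<le> \<eta>" by simp
      moreover have "\<eta> / k \<le> \<eta>"
        using k \<open>\<eta> > 0\<close> by (simp add: divide_le_eq)
      ultimately show "\<exists>s. 0 < s \<and> s < \<eta> \<and> z s \<le> \<eta>"
        using s by (intro exI[of _ s]) auto
    qed
    moreover have "z r = r ^ N * (sg * (deriv u r / r + C) - E)"
    proof -
      have "r ^ N = r * r ^ (N - 1)"
        using N by (simp add: power_eq_if)
      then have "v r = r ^ N * (deriv u r / r)"
        using r by (simp add: v_def)
      then show ?thesis
        by (simp add: z_def algebra_simps)
    qed
    ultimately have "sg * (deriv u r / r + C) - E \<le> 0"
      using zero_less_power[OF r, of N] by (auto simp: mult_le_0_iff)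
    then have "sg * (deriv u r / r + c / real N) \<le> e / real N"
      by (simp add: C_def E_def)
    also have "\<dots> \<le> e"
      using e N by (simp add: divide_le_eq)
    finally show ?thesis .
  qed
  show ?thesis
  proof (rule tendstoI)
    fix e :: real assume e: "e > 0"
    have "((\<lambda>r. f (u r)) \<longlongrightarrow> c) (at_right 0)"
      unfolding c_def by (rule isCont_tendsto_compose[OF f cont0])
    then have "eventually (\<lambda>r. dist (f (u r)) c < e / 2) (at_right 0)"
      using e by (intro tendstoD) auto
    then obtain d where d: "d > 0" "\<And>r. 0 < r \<Longrightarrow> r < d \<Longrightarrow> dist (f (u r)) c < e / 2"
      unfolding eventually_at_right_field by auto
    have "dist (deriv u r / r) (- f (u 0) / real N) < e" if "r \<in> {0<..<d}" for r
    proof -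
      have "\<bar>f (u s) - c\<bar> \<le> e / 2" if "0 < s" "s \<le> r" for s
        using d(2)[of s] that \<open>r \<in> _\<close> by (auto simp: dist_real_def)
      then have both: "sg * (deriv u r / r + c / real N) \<le> e / 2" if "sg = 1 \<or> sg = -1" for sg
        using bound[of "e / 2" r sg] e that \<open>r \<in> _\<close> by auto
      have "\<bar>deriv u r / r + c / real N\<bar> \<le> e / 2"
        using both[of 1] both[of "-1"] unfolding abs_le_iff by (simp only: mult_1 mult_minus1) simp
      then show ?thesis
        using e by (simp add: dist_real_def c_def)
    qed
    with eventually_at_right_real[OF d(1)]
    show "\<forall>\<^sub>F r in at_right 0. dist (deriv u r / r) (- f (u 0) / real N) < e"
      by (rule eventually_mono) auto
  qed
qed

lemma filterlim_norm_at_right_0: "filterlim norm (at_right 0) (at (0 :: 'a::real_normed_vector))"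
  unfolding filterlim_at
  by (auto simp: eventually_at_filter intro: tendsto_norm_zero tendsto_ident_at)

lemma continuous_on_if_origin:
  fixes F :: "'a::real_normed_vector \<Rightarrow> real"
  assumes "continuous_on (- {0}) F" and "(F \<longlongrightarrow> l) (at 0)"
  shows "continuous_on UNIV (\<lambda>x. if x = 0 then l else F x)" (is "continuous_on _ ?G")
proof (intro continuous_at_imp_continuous_on ballI)
  fix x :: 'a
  show "isCont ?G x"
  proof (cases "x = 0")
    case True
    have "(?G \<longlongrightarrow> l) (at 0)"
      using assms(2) by (rule Lim_transform_eventually) (auto simp: eventually_at_filter)
    with True show ?thesis by (simp add: isCont_def)
  next
    case False
    have "continuous_on (- {0}) ?G"
      using assms(1) by (rule continuous_on_eq) auto
    with False show ?thesis by (simp add: continuous_on_eq_continuous_at open_Compl)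
  qed
qed

text \<open>The gradient of \<open>w\<close> is g(x) x, where g is u'(r)/r extended by its limit
  \<open>a\<close>. The Hessian has entries m(|x|) sgn(x)_i sgn(x)_j + g(x) delta_ij. It is
  continuous because m tends to 0 at the origin, and its trace m + N g is -f(w).\<close>

lemma regular_radial_solution_lift:
  assumes reg: "regular_radial_solution CARD('n) f \<alpha> u" and N: "CARD('n::finite) \<ge> 2"
    and f: "continuous_on UNIV f"
  defines "w \<equiv> \<lambda>x :: real ^ 'n. u (norm x)"
  shows "C2_function w" and "laplacian w x + f (w x) = 0"
proof -
  let ?N = "real CARD('n)"
  have ode: "radial_ode CARD('n) f u" and u0: "u 0 = \<alpha>"
    and du0: "(u has_real_derivative 0) (at 0 within {0..})"
    using reg by (auto simp: regular_radial_solution_def)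
  note D = radial_odeD[OF ode]
  define a where "a = - f (u 0) / ?N"
  define k where "k r = deriv u r / r" for r
  \<comment> \<open>This is u'' - u'/r with u'' eliminated by the equation. In this form its limit
    at 0 follows from that of \<open>k\<close>: the value of \<open>a\<close> makes it
    vanish.\<close>
  define m where "m r = - ?N * k r - f (u r)" for r
  define g where "g x = (if x = 0 then a else k (norm x))" for x :: "real ^ 'n"
  have fcont: "isCont f y" for y
    using f by (simp add: continuous_on_eq_continuous_at)
  have k0: "(k \<longlongrightarrow> a) (at_right 0)"
    unfolding k_def a_def using regular_radial_deriv_over_r[OF ode N du0 fcont] by simp
  have cont0: "(u \<longlongrightarrow> u 0) (at_right 0)"
  proof -
    have "(u \<longlongrightarrow> u 0) (at 0 within {0..})"
      using DERIV_continuous[OF du0] by (simp add: continuous_within)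
    then show ?thesis by (rule tendsto_within_subset) auto
  qed
  have m0: "(m \<longlongrightarrow> 0) (at_right 0)"
  proof -
    have "(m \<longlongrightarrow> - ?N * a - f (u 0)) (at_right 0)"
      unfolding m_def by (intro tendsto_intros k0 isCont_tendsto_compose[OF fcont cont0])
    then show ?thesis using N by (simp add: a_def)
  qed
  have kc: "continuous_on {0<..} k"
    unfolding k_def by (intro continuous_intros D) auto
  have mc: "continuous_on {0<..} m"
    unfolding m_def by (intro continuous_intros kc continuous_on_compose2[OF f D(3)]) auto
  have gc: "continuous_on UNIV g"
    unfolding g_def
    by (intro continuous_on_if_origin continuous_on_compose2[OF kc]
        filterlim_compose[OF k0 filterlim_norm_at_right_0] continuous_intros) auto
  have kd: "(k has_real_derivative m r / r) (at r)" if "r > 0" for r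
    unfolding k_def
    by (rule derivative_eq_intros refl D(2) that)+
       (use that D(5)[OF that] in \<open>auto simp: m_def k_def field_simps\<close>)
  have wd: "(w has_derivative (\<lambda>h. g x * (x \<bullet> h))) (at x)" for x
  proof (cases "x = 0")
    case True
    have "((\<lambda>r. (u r - u 0) / r) \<longlongrightarrow> 0) (at 0 within {0..})"
      using du0 by (simp add: has_field_derivative_iff)
    then have "((\<lambda>r. (u r - u 0) / r) \<longlongrightarrow> 0) (at_right 0)"
      by (rule tendsto_within_subset) auto
    from tendsto_norm_zero[OF filterlim_compose[OF this filterlim_norm_at_right_0[where 'a = "real ^ 'n"]]]
    show ?thesis
      using True by (simp add: has_derivative_at w_def)
  next
    case False
    then have "(u has_real_derivative deriv u (norm x)) (at (norm x))"
      by (intro D) simp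
    from has_derivative_radial[OF False this] show ?thesis
      using False by (simp add: w_def g_def k_def sgn_div_norm divide_inverse mult_ac)
  qed
  have pd: "partial_derivative i w = (\<lambda>x. g x * x $ i)" for i
    using partial_derivativeI[OF wd] by (simp add: inner_axis fun_eq_iff)
  have pdd: "((\<lambda>x. g x * x $ i) has_derivative (\<lambda>h. m (norm x) * (sgn x \<bullet> h) * sgn x $ i + g x * h $ i)) (at x)"
    for i and x :: "real ^ 'n"
  proof (cases "x = 0")
    case True
    \<comment> \<open>At the origin the derivative of g(h) h_i is a h_i: the error is at most |g(h)
      - a| |h|, and g is continuous.\<close>
    have "((\<lambda>h. g h - a) \<longlongrightarrow> 0) (at (0 :: real ^ 'n))"
    proof -
      have "(g \<longlongrightarrow> g 0) (at 0)"
        using gc by (auto simp: continuous_on_eq_continuous_at isCont_def)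
      from LIM_zero[OF this] show ?thesis
        by (simp add: g_def[of 0])
    qed
    then have "((\<lambda>h. norm (g h * h $ i - a * h $ i) / norm h) \<longlongrightarrow> 0) (at (0 :: real ^ 'n))"
    proof (rule Lim_null_comparison[OF eventuallyI, rotated, OF tendsto_norm_zero])
      fix h :: "real ^ 'n"
      have "norm (g h * h $ i - a * h $ i) \<le> norm (g h - a) * norm h"
        by (simp add: left_diff_distrib[symmetric] abs_mult component_le_norm_cart mult_left_mono)
      then show "norm (norm (g h * h $ i - a * h $ i) / norm h) \<le> norm (g h - a)"
        by (cases "h = 0") (auto simp: divide_le_eq)
    qed
    moreover have "bounded_linear (\<lambda>h :: real ^ 'n. a * h $ i)"
      by (intro bounded_linear_const_mult bounded_linear_vec_nth)
    ultimately show ?thesis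
      using True by (simp add: has_derivative_at g_def[of 0])
  next
    case False
    have "((\<lambda>x. k (norm x)) has_derivative (\<lambda>h. m (norm x) / norm x * (sgn x \<bullet> h))) (at x)"
      using False by (intro has_derivative_radial kd) auto
    then have "((\<lambda>x. k (norm x) * x $ i) has_derivative
        (\<lambda>h. k (norm x) * h $ i + m (norm x) / norm x * (sgn x \<bullet> h) * x $ i)) (at x)"
      by (intro has_derivative_mult bounded_linear.has_derivative[OF bounded_linear_vec_nth] has_derivative_ident)
    then have "((\<lambda>x. g x * x $ i) has_derivative
        (\<lambda>h. k (norm x) * h $ i + m (norm x) / norm x * (sgn x \<bullet> h) * x $ i)) (at x)"
      by (rule has_derivative_transform_within_open[of _ _ _ _ "- {0}"]) (use False in \<open>auto simp: g_def\<close>)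
    moreover have "(\<lambda>h. k (norm x) * h $ i + m (norm x) / norm x * (sgn x \<bullet> h) * x $ i) =
        (\<lambda>h. m (norm x) * (sgn x \<bullet> h) * sgn x $ i + g x * h $ i)"
      using False by (simp add: fun_eq_iff g_def sgn_div_norm divide_inverse mult_ac)
    ultimately show ?thesis by simp
  qed
  have pd2: "partial_derivative j (\<lambda>x. g x * x $ i) =
      (\<lambda>x. m (norm x) * sgn x $ j * sgn x $ i + g x * axis j 1 $ i)" for i j
    using partial_derivativeI[OF pdd] by (simp add: inner_axis fun_eq_iff)
  \<comment> \<open>\<open>sgn\<close> is discontinuous at the origin, but its components are
    bounded by 1 and the factor \<open>m\<close> tends to 0.\<close>
  have cont2: "continuous_on UNIV (\<lambda>x :: real ^ 'n. m (norm x) * sgn x $ j * sgn x $ i)" for i j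
  proof -
    have "continuous_on UNIV (\<lambda>x :: real ^ 'n. if x = 0 then 0 else m (norm x) * sgn x $ j * sgn x $ i)"
    proof (rule continuous_on_if_origin)
      show "continuous_on (- {0}) (\<lambda>x :: real ^ 'n. m (norm x) * sgn x $ j * sgn x $ i)"
        unfolding sgn_div_norm
        by (intro continuous_intros continuous_on_compose2[OF mc]) auto
      have "((\<lambda>x :: real ^ 'n. m (norm x)) \<longlongrightarrow> 0) (at 0)"
        by (rule filterlim_compose[OF m0 filterlim_norm_at_right_0])
      then show "((\<lambda>x :: real ^ 'n. m (norm x) * sgn x $ j * sgn x $ i) \<longlongrightarrow> 0) (at 0)"
      proof (rule Lim_null_comparison[OF eventuallyI, rotated, OF tendsto_norm_zero])
        fix x :: "real ^ 'n"
        have "\<bar>sgn x $ l\<bar> \<le> 1" for l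
          using component_le_norm_cart[of "sgn x" l] by (auto simp: norm_sgn split: if_splits)
        then have "\<bar>sgn x $ j\<bar> * \<bar>sgn x $ i\<bar> \<le> 1"
          by (simp add: mult_le_one)
        then show "norm (m (norm x) * sgn x $ j * sgn x $ i) \<le> norm (m (norm x))"
          using mult_left_mono[of "\<bar>sgn x $ j\<bar> * \<bar>sgn x $ i\<bar>" 1 "\<bar>m (norm x)\<bar>"] by (simp add: abs_mult mult_ac)
      qed
    qed
    then show ?thesis
      by (rule continuous_on_eq) auto
  qed
  show "C2_function w"
    unfolding C2_function_def C1_function_def pd pd2 differentiable_def
    using wd pdd by (auto intro!: continuous_intros gc cont2)
  have "laplacian w x = (\<Sum>i\<in>UNIV. m (norm x) * (sgn x $ i * sgn x $ i) + g x)"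
    by (simp add: laplacian_def pd pd2 mult_ac)
  also have "\<dots> = m (norm x) * (sgn x \<bullet> sgn x) + ?N * g x"
    by (simp add: sum.distrib inner_vec_def flip: sum_distrib_left)
  also have "\<dots> = - f (w x)"
    using N by (cases "x = 0") (auto simp: dot_square_norm norm_sgn g_def m_def w_def a_def)
  finally show "laplacian w x + f (w x) = 0" by simp
qed

section \<open>Comparison with the stable singular potential\<close>

text \<open>Extending \<open>p\<close> by zero may create corners at \<open>a\<close> and
  \<open>b\<close>, so the extension need not be a C1 test function. It is approximated by smoothed
  functions with no larger slope. Since \<open>V\<close> is nonnegative, the loss in the potential
  term is at most \<open>d * K\<close>, and \<open>d\<close> tends to 0.\<close>

lemma radial_quadratic_form_nonneg_Dirichlet:
  assumes stab: "nonneg_quadratic_form (\<lambda>x :: real ^ 'n::finite. V (norm x))"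
    and V: "continuous_on {a..b} V" and Vnn: "\<And>r. r \<in> {a..b} \<Longrightarrow> V r \<ge> 0"
    and ab: "0 < a" "a < b"
    and p: "\<And>r. r > 0 \<Longrightarrow> (p has_real_derivative p' r) (at r)" and p': "continuous_on {0<..} p'"
    and pnn: "\<And>r. r \<in> {a..b} \<Longrightarrow> p r \<ge> 0" and pa: "p a = 0" and pb: "p b = 0"
  shows "integral {a..b} (\<lambda>r. r ^ (CARD('n) - 1) * ((p' r)\<^sup>2 - V r * (p r)\<^sup>2)) \<ge> 0"
    (is "?I \<ge> 0")
proof -
  let ?n = "CARD('n) - 1"
  define K where "K = integral {a..b} (\<lambda>r. r ^ ?n * (2 * V r * p r))"
  have pc: "continuous_on {a..b} p"
    using ab by (intro continuous_at_imp_continuous_on ballI DERIV_isCont[OF p]) auto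
  have p'c: "continuous_on {a..b} p'"
    using p' ab by (auto elim: continuous_on_subset)
  have key: "0 \<le> ?I + d * K" if d: "d > 0" for d
  proof -
    \<comment> \<open>Composing with \<open>t \<mapsto> t\<^sup>2 / (t + d)\<close>, whose derivative vanishes at \<open>0\<close>,
      removes the kinks of the extension of \<open>p\<close> by \<open>0\<close>.\<close>
    define h h' :: "real \<Rightarrow> real" where "h t = t\<^sup>2 / (t + d)" and "h' t = (t\<^sup>2 + 2 * d * t) / (t + d)\<^sup>2" for t
    \<comment> \<open>Clamping to \<open>{a..b}\<close> evaluates \<open>p\<close> only where it is
      nonnegative; outside the interval it returns an end point, where \<open>p\<close> is
      zero.\<close>
    define c where "c r = max a (min b r)" for r
    have c: "c r \<in> {a..b}" "r \<in> {a..b} \<Longrightarrow> c r = r" for r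
      using ab by (auto simp: c_def)
    have hd: "(h has_real_derivative h' t) (at t)" if "t \<ge> 0" for t
      unfolding h_def h'_def using that d
      by (auto intro!: derivative_eq_intros simp: field_simps power2_eq_square)
    have h'1: "0 \<le> h' t" "h' t \<le> 1" if "t \<ge> 0" for t
    proof -
      have "t\<^sup>2 + 2 * d * t \<le> (t + d)\<^sup>2"
        by (simp add: power2_sum mult_ac)
      then show "0 \<le> h' t" "h' t \<le> 1"
        using that d by (auto simp: h'_def divide_le_eq_1_pos intro!: divide_nonneg_nonneg)
    qed
    have hle: "t\<^sup>2 - (h t)\<^sup>2 \<le> 2 * d * t" "0 \<le> h t" "h t \<le> t\<^sup>2 / d" if "t \<ge> 0" for t
    proof -
      \<comment> \<open>The difference t - h(t) = t d / (t + d) lies between 0 and d; multiplying by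
        t + h(t) \<le> 2 t bounds the loss in the square.\<close>
      have "h t = t - t * d / (t + d)"
        using that d by (simp add: h_def field_simps power2_eq_square)
      moreover have "t * d / (t + d) \<le> d" "t * d / (t + d) \<ge> 0"
        using that d by (auto simp: field_simps)
      ultimately have 1: "t - h t \<le> d" "h t \<le> t" "0 \<le> t - h t"
        by linarith+
      show "0 \<le> h t" "h t \<le> t\<^sup>2 / d"
        using that d by (auto simp: h_def intro!: divide_left_mono)
      have "(t - h t) * (t + h t) \<le> d * (2 * t)"
        using 1 that \<open>0 \<le> h t\<close> d by (intro mult_mono) auto
      then show "t\<^sup>2 - (h t)\<^sup>2 \<le> 2 * d * t"
        by (simp add: algebra_simps power2_eq_square)
    qed
    define P P' where "P r = h (p (c r))" and "P' r = h' (p (c r)) * p' (c r)" for r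
    have h00: "h 0 = 0" "h' 0 = 0" by (simp_all add: h_def h'_def)
    have out: "P r = 0" "P' r = 0" if "r \<notin> {a..b}" for r
      using that ab by (auto simp: P_def P'_def c_def h00 pa pb min_def max_def)
    have Pd: "(P has_real_derivative P' r) (at r)" for r
    proof -
      consider "r < a \<or> b < r" | "a < r" "r < b" | "r = a \<or> r = b"
        by linarith
      then show ?thesis
      proof cases
        case 1
        have "(P has_real_derivative 0) (at r)"
          by (rule has_field_derivative_transform_within_open[of "\<lambda>_. 0" _ _ "- {a..b}"])
             (use 1 out in auto)
        with 1 out show ?thesis by auto
      next
        case 2
        have "((\<lambda>r. h (p r)) has_real_derivative h' (p r) * p' r) (at r)"
          using 2 ab pnn[of r] by (intro DERIV_chain2[OF hd p]) auto
        then have "(P has_real_derivative h' (p r) * p' r) (at r)"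
          by (rule has_field_derivative_transform_within_open[where S = "{a<..<b}"])
             (use 2 c in \<open>auto simp: P_def\<close>)
        with 2 c show ?thesis by (simp add: P'_def)
      next
        case 3
        then have r: "r > 0" "p r = 0" "P r = 0" "P' r = 0" "c r = r"
          using ab pa pb c(2)[of r] by (auto simp: P_def P'_def h00)
        \<comment> \<open>At an end point \<open>P\<close> is dominated by p^2 / d, which has
          derivative 0 there since \<open>p\<close> vanishes.\<close>
        have "((\<lambda>s. (p s)\<^sup>2 / d) has_real_derivative 0) (at r)"
          using r d by (auto intro!: derivative_eq_intros p)
        then have "((\<lambda>s. ((p s)\<^sup>2 / d) / (s - r)) \<longlongrightarrow> 0) (at r)"
          using r by (simp add: has_field_derivative_iff)
        then have "((\<lambda>s. P s / (s - r)) \<longlongrightarrow> 0) (at r)"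
        proof (rule Lim_null_comparison[OF eventuallyI, rotated, OF tendsto_norm_zero])
          fix s
          have "\<bar>P s\<bar> \<le> (p s)\<^sup>2 / d"
          proof (cases "s \<in> {a..b}")
            case True
            then show ?thesis
              using hle(2,3)[OF pnn[OF True]] c by (simp add: P_def)
          next
            case False
            with d show ?thesis by (simp add: out)
          qed
          then have "\<bar>P s\<bar> \<le> \<bar>(p s)\<^sup>2 / d\<bar>" by linarith
          then show "norm (P s / (s - r)) \<le> norm ((p s)\<^sup>2 / d / (s - r))"
            unfolding real_norm_def abs_divide[of _ "s - r"] by (intro divide_right_mono) auto
        qed
        then show ?thesis
          using r by (simp add: has_field_derivative_iff)
      qed
    qed
    have h'c: "continuous_on {0..} h'"
      unfolding h'_def using d by (intro continuous_intros) auto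
    have cc: "continuous_on UNIV c"
      unfolding c_def by (intro continuous_intros)
    have P'c: "continuous_on UNIV P'"
      unfolding P'_def using c(1) pnn
      by (intro continuous_intros continuous_on_compose2[OF h'c]
           continuous_on_compose2[OF pc cc] continuous_on_compose2[OF p'c cc]) auto
    have "0 \<le> integral {a..b} (\<lambda>r. r ^ ?n * ((P' r)\<^sup>2 - V r * (P r)\<^sup>2))"
      by (rule radial_quadratic_form_nonneg[OF stab V ab(1) Pd P'c out])
    also have "\<dots> \<le> integral {a..b} (\<lambda>r. r ^ ?n * ((p' r)\<^sup>2 - V r * (p r)\<^sup>2) + d * (r ^ ?n * (2 * V r * p r)))"
    proof (rule integral_le)
      have "continuous_on {a..b} P"
        using Pd by (intro DERIV_continuous_on) (auto intro: has_field_derivative_at_within)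
      moreover have "continuous_on {a..b} P'"
        using P'c continuous_on_subset by blast
      ultimately show "(\<lambda>r. r ^ ?n * ((P' r)\<^sup>2 - V r * (P r)\<^sup>2)) integrable_on {a..b}"
        by (intro integrable_continuous_interval continuous_intros V)
      show "(\<lambda>r. r ^ ?n * ((p' r)\<^sup>2 - V r * (p r)\<^sup>2) + d * (r ^ ?n * (2 * V r * p r))) integrable_on {a..b}"
        by (intro integrable_continuous_interval continuous_intros V pc p'c)
      fix r assume r: "r \<in> {a..b}"
      note pr = pnn[OF r]
      have "(P' r)\<^sup>2 \<le> (p' r)\<^sup>2"
      proof -
        have "(h' (p r))\<^sup>2 \<le> 1"
          using h'1[OF pr] by (simp add: power_le_one)
        then have "(h' (p r))\<^sup>2 * (p' r)\<^sup>2 \<le> 1 * (p' r)\<^sup>2"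
          by (intro mult_right_mono) auto
        then show ?thesis
          using c(2)[OF r] by (simp add: P'_def power_mult_distrib)
      qed
      moreover have "V r * ((p r)\<^sup>2 - (P r)\<^sup>2) \<le> V r * (2 * d * p r)"
        using hle(1)[OF pr] Vnn[OF r] c(2)[OF r] by (intro mult_left_mono) (auto simp: P_def)
      ultimately have "(P' r)\<^sup>2 - V r * (P r)\<^sup>2 \<le> (p' r)\<^sup>2 - V r * (p r)\<^sup>2 + d * (2 * V r * p r)"
        by (simp add: algebra_simps)
      then have "r ^ ?n * ((P' r)\<^sup>2 - V r * (P r)\<^sup>2) \<le> r ^ ?n * ((p' r)\<^sup>2 - V r * (p r)\<^sup>2 + d * (2 * V r * p r))"
        using r ab by (intro mult_left_mono) auto
      then show "r ^ ?n * ((P' r)\<^sup>2 - V r * (P r)\<^sup>2) \<le> r ^ ?n * ((p' r)\<^sup>2 - V r * (p r)\<^sup>2) + d * (r ^ ?n * (2 * V r * p r))"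
        by (simp add: algebra_simps)
    qed
    also have "\<dots> = ?I + integral {a..b} (\<lambda>r. d * (r ^ ?n * (2 * V r * p r)))"
      by (intro Henstock_Kurzweil_Integration.integral_add integrable_continuous_interval continuous_intros V pc p'c)
    finally show ?thesis by (simp add: K_def)
  qed
  have "((\<lambda>d. ?I + d * K) \<longlongrightarrow> ?I + 0 * K) (at_right 0)"
    by (intro tendsto_intros)
  moreover have "eventually (\<lambda>d. 0 \<le> ?I + d * K) (at_right 0)"
    using key by (auto simp: eventually_at_filter)
  ultimately show ?thesis
    using tendsto_lowerbound trivial_limit_at_right_real by fastforce
qed

text \<open>The test function is p = w e, with \<open>e\<close> a logarithmic cutoff rising from 0
  at \<open>a\<close> to 1 at \<open>R\<close>. Integration by parts turns the form into the cutoff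
  error, the integral of r^(N-1) (w e')^2, minus the integral of e^2 Q. By \<open>bound\<close> the
  error is at most C / L with L = ln(R/a), while the second integral stays above a positive
  constant.\<close>

lemma no_positive_strict_subsolution:
  assumes stab: "nonneg_quadratic_form (\<lambda>x :: real ^ 'n::finite. V (norm x))"
    and V: "continuous_on {0<..} V" and Vnn: "\<And>r. r > 0 \<Longrightarrow> V r \<ge> 0"
    and N: "CARD('n) \<ge> 2"
    and w: "\<And>r. r > 0 \<Longrightarrow> (w has_real_derivative w' r) (at r)" and w': "continuous_on {0<..} w'"
    and flux: "\<And>r. r > 0 \<Longrightarrow>
      ((\<lambda>r. r ^ (CARD('n) - 1) * w' r) has_real_derivative - (r ^ (CARD('n) - 1) * g r)) (at r)"
    and g: "continuous_on {0<..} g"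
    and R: "R > 0" "w R = 0" and wpos: "\<And>r. 0 < r \<Longrightarrow> r < R \<Longrightarrow> w r > 0"
    and sub: "\<And>r. 0 < r \<Longrightarrow> r < R \<Longrightarrow> g r < V r * w r"
    and bound: "\<And>r. 0 < r \<Longrightarrow> r < R \<Longrightarrow> r ^ (CARD('n) - 2) * (w r)\<^sup>2 \<le> C"
  shows False
proof -
  let ?n = "CARD('n) - 1"
  \<comment> \<open>The weighted defect of strictness: positive inside the ball by
    \<open>sub\<close>.\<close>
  define Q where "Q r = r ^ ?n * (w r * (V r * w r - g r))" for r
  have wc: "continuous_on {0<..} w"
    using w by (intro DERIV_continuous_on) (auto intro: has_field_derivative_at_within)
  have Qc: "continuous_on {0<..} Q"
    unfolding Q_def by (intro continuous_intros wc V g)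
  have Qpos: "Q r > 0" if "0 < r" "r < R" for r
    using wpos[OF that] sub[OF that] that by (simp add: Q_def)
  have Qnn: "Q r \<ge> 0" if "0 < r" "r \<le> R" for r
    using Qpos[of r] that R by (cases "r = R") (auto simp: Q_def)
  have "0 \<le> (R / 2) ^ (CARD('n) - 2) * (w (R / 2))\<^sup>2"
    using R by simp
  \<comment> \<open>At r = R the hypothesis \<open>bound\<close> says nothing, but w(R) = 0, so the
    estimate extends to R once \<open>C\<close> is nonnegative.\<close>
  then have Cnn: "C \<ge> 0"
    using bound[of "R / 2"] R by linarith
  obtain m where m: "m > 0" "\<And>r. r \<in> {R / 4..R / 2} \<Longrightarrow> Q r \<ge> m"
  proof -
    have "continuous_on {R / 4..R / 2} Q"
      using R by (intro continuous_on_subset[OF Qc]) auto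
    then obtain r0 where "r0 \<in> {R / 4..R / 2}" "\<And>r. r \<in> {R / 4..R / 2} \<Longrightarrow> Q r0 \<le> Q r"
      using continuous_attains_inf[of "{R / 4..R / 2}" Q] R by force
    with that[of "Q r0"] Qpos[of r0] R show ?thesis by auto
  qed
  \<comment> \<open>The first entry forces a \<le> R/16, which makes e \<ge> 1/2 on
    \<open>{R / 4..R / 2}\<close>; the second makes C / L smaller than m R / 16. Writing C + 1 keeps
    this strict also for C = 0.\<close>
  define L where "L = max (ln 16) (16 * (C + 1) / (m * R))"
  have L0: "L > 0"
    by (simp add: L_def less_max_iff_disj)
  have L: "L \<ge> ln 16" "16 * C < L * (m * R)"
  proof -
    have mR: "m * R > 0" using m R by simp
    then have "16 * C < (16 * (C + 1) / (m * R)) * (m * R)"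
      using m R by simp
    also have "\<dots> \<le> L * (m * R)"
      using mR by (intro mult_right_mono) (auto simp: L_def)
    finally show "16 * C < L * (m * R)" .
  qed (simp add: L_def)
  define a where "a = R * exp (- L)"
  have a: "0 < a" "a \<le> R / 16"
  proof -
    have "exp (- L) \<le> exp (- ln 16)" using L by simp
    then show "a \<le> R / 16" using R by (simp add: a_def exp_minus field_simps)
  qed (simp add: a_def R)
  have aR: "a < R" using a R by simp
  have lna: "ln a = ln R - L"
    using R by (simp add: a_def ln_mult)
  define e where "e r = (ln r - ln a) / L" for r
  have e: "e a = 0" "e R = 1"
    using L0 by (simp_all add: e_def lna)
  have ed: "(e has_real_derivative 1 / (r * L)) (at r)" if "r > 0" for r
    unfolding e_def using that L0 by (auto intro!: derivative_eq_intros simp: field_simps)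
  have ec: "continuous_on {0<..} e"
    unfolding e_def using L0 by (intro continuous_intros) auto
  define p p' where "p r = w r * e r" and "p' r = w' r * e r + w r / (r * L)" for r
  \<comment> \<open>The boundary term of the integration by parts, flux times e^2 w. It vanishes at
    \<open>a\<close> because of the cutoff and at \<open>R\<close> because w(R) = 0.\<close>
  define G where "G r = (r ^ ?n * w' r) * ((e r)\<^sup>2 * w r)" for r
  define G' where "G' r = r ^ ?n * (w' r * (2 * e r / (r * L) * w r + (e r)\<^sup>2 * w' r) - g r * (e r)\<^sup>2 * w r)" for r
  have pd: "(p has_real_derivative p' r) (at r)" if "r > 0" for r
    unfolding p_def p'_def using that L0 by (auto intro!: derivative_eq_intros w ed simp: field_simps)
  have p'c: "continuous_on {0<..} p'"
    unfolding p'_def using L0 by (intro continuous_intros w' wc ec) auto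
  have Gd: "(G has_real_derivative G' r) (at r)" if "r > 0" for r
  proof -
    have "((\<lambda>r. (e r)\<^sup>2 * w r) has_real_derivative
        2 * e r * (1 / (r * L)) * w r + w' r * (e r)\<^sup>2) (at r)"
      using that by (auto intro!: derivative_eq_intros ed w)
    from DERIV_mult[OF flux[OF that] this]
    have "(G has_real_derivative (- (r ^ ?n * g r) * ((e r)\<^sup>2 * w r)
        + (2 * e r * (1 / (r * L)) * w r + w' r * (e r)\<^sup>2) * (r ^ ?n * w' r))) (at r)"
      by (simp add: G_def[abs_def])
    moreover have "- (r ^ ?n * g r) * ((e r)\<^sup>2 * w r) + (2 * e r * (1 / (r * L)) * w r + w' r * (e r)\<^sup>2) * (r ^ ?n * w' r) = G' r"
      by (simp add: G'_def algebra_simps)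
    ultimately show ?thesis by simp
  qed
  have "0 \<le> integral {a..R} (\<lambda>r. r ^ ?n * ((p' r)\<^sup>2 - V r * (p r)\<^sup>2))"
  proof (rule radial_quadratic_form_nonneg_Dirichlet[OF stab _ _ a(1) aR pd p'c])
    show "continuous_on {a..R} V"
      using a by (intro continuous_on_subset[OF V]) auto
    show "V r \<ge> 0" if "r \<in> {a..R}" for r
      using that a by (intro Vnn) auto
    show "p a = 0" "p R = 0"
      by (simp_all add: p_def e R)
    show "p r \<ge> 0" if "r \<in> {a..R}" for r
    proof -
      have "w r \<ge> 0" using that a wpos[of r] R by (cases "r = R") auto
      moreover have "e r \<ge> 0" using that a L0 by (auto simp: e_def)
      ultimately show ?thesis by (simp add: p_def)
    qed
  qed
  also have "\<dots> \<le> integral {a..R} (\<lambda>r. C / L\<^sup>2 / r + G' r - (e r)\<^sup>2 * Q r)"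
  proof (rule integral_le)
    have sub: "{a..R} \<subseteq> {0<..}" using a by auto
    note cs = continuous_on_subset[OF _ sub]
    show "(\<lambda>r. r ^ ?n * ((p' r)\<^sup>2 - V r * (p r)\<^sup>2)) integrable_on {a..R}"
      unfolding p_def
      by (intro integrable_continuous_interval continuous_intros cs[OF V] cs[OF p'c] cs[OF wc] cs[OF ec])
    show "(\<lambda>r. C / L\<^sup>2 / r + G' r - (e r)\<^sup>2 * Q r) integrable_on {a..R}"
      unfolding G'_def using a L0
      by (intro integrable_continuous_interval continuous_intros cs[OF Qc] cs[OF wc] cs[OF ec] cs[OF w'] cs[OF g]) auto
    fix r assume r: "r \<in> {a..R}"
    then have r0: "r > 0" using a by auto
    have rn: "r ^ ?n = r * r ^ (CARD('n) - 2)"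
      using N by (metis Suc_diff_le Suc_1 diff_Suc_Suc power_Suc One_nat_def)
    have "r ^ (CARD('n) - 2) * (w r)\<^sup>2 \<le> C"
      using bound[of r] r r0 R Cnn by (cases "r = R") auto
    then have "r ^ (CARD('n) - 2) * (w r)\<^sup>2 / (r * L\<^sup>2) \<le> C / (r * L\<^sup>2)"
      using r0 by (intro divide_right_mono) auto
    moreover have "r ^ (CARD('n) - 2) * (w r)\<^sup>2 / (r * L\<^sup>2) = r ^ ?n * (w r / (r * L))\<^sup>2"
      unfolding rn using r0 L0 by (simp add: power2_eq_square field_simps)
    \<comment> \<open>Expanding the square, the mixed term and the w'^2 term are exactly those of
      \<open>G'\<close>; what remains is the cutoff error and the defect.\<close>
    moreover have "r ^ ?n * ((p' r)\<^sup>2 - V r * (p r)\<^sup>2) = r ^ ?n * (w r / (r * L))\<^sup>2 + G' r - (e r)\<^sup>2 * Q r"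
    proof -
      define y where "y = 1 / (r * L)"
      have "r ^ ?n * ((w' r * e r + w r * y)\<^sup>2 - V r * (w r * e r)\<^sup>2) = r ^ ?n * (w r * y)\<^sup>2
          + r ^ ?n * (w' r * (2 * e r * y * w r + (e r)\<^sup>2 * w' r) - g r * (e r)\<^sup>2 * w r) - (e r)\<^sup>2 * Q r"
        unfolding Q_def by (simp add: algebra_simps power2_eq_square)
      then show ?thesis
        by (simp add: p_def p'_def G'_def y_def)
    qed
    ultimately show "r ^ ?n * ((p' r)\<^sup>2 - V r * (p r)\<^sup>2) \<le> C / L\<^sup>2 / r + G' r - (e r)\<^sup>2 * Q r"
      by (simp add: mult.commute)
  qed
  also have "\<dots> = C / L - integral {a..R} (\<lambda>r. (e r)\<^sup>2 * Q r)"
  proof (rule integral_unique, rule has_integral_diff)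
    \<comment> \<open>The error density C / (L^2 r) integrates to C (ln R - ln a) / L^2 = C /
      L.\<close>
    have "((\<lambda>r. C / L\<^sup>2 / r + G' r) has_integral
        (C / L\<^sup>2 * ln R + G R - (C / L\<^sup>2 * ln a + G a))) {a..R}"
    proof (rule fundamental_theorem_of_calculus)
      fix r assume "r \<in> {a..R}"
      then have "((\<lambda>r. C / L\<^sup>2 * ln r + G r) has_real_derivative C / L\<^sup>2 / r + G' r) (at r)"
        using DERIV_add[OF DERIV_cmult[OF DERIV_ln_divide[of r], of "C / L\<^sup>2"] Gd[of r]] a by auto
      then show "((\<lambda>r. C / L\<^sup>2 * ln r + G r) has_vector_derivative C / L\<^sup>2 / r + G' r) (at r within {a..R})"
        by (simp add: has_real_derivative_iff_has_vector_derivative has_vector_derivative_at_within)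
    qed (use aR in simp)
    moreover have "C / L\<^sup>2 * ln R + G R - (C / L\<^sup>2 * ln a + G a) = C / L"
      using L0 by (simp add: G_def e R lna power2_eq_square field_simps)
    ultimately show "((\<lambda>r. C / L\<^sup>2 / r + G' r) has_integral C / L) {a..R}" by simp
    show "((\<lambda>r. (e r)\<^sup>2 * Q r) has_integral integral {a..R} (\<lambda>r. (e r)\<^sup>2 * Q r)) {a..R}"
      using a by (intro integrable_integral integrable_continuous_interval continuous_intros
        continuous_on_subset[OF Qc] continuous_on_subset[OF ec]) auto
  qed
  finally have upper: "0 \<le> C / L - integral {a..R} (\<lambda>r. (e r)\<^sup>2 * Q r)" .
  have lower: "integral {a..R} (\<lambda>r. (e r)\<^sup>2 * Q r) \<ge> m * R / 16"
  proof -
    have int: "(\<lambda>r. (e r)\<^sup>2 * Q r) integrable_on {c..d}" if "c > 0" for c d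
      using that by (intro integrable_continuous_interval continuous_intros
        continuous_on_subset[OF Qc] continuous_on_subset[OF ec]) auto
    \<comment> \<open>On an interval of length R/4 the integrand is at least m/4.\<close>
    have "m * R / 16 = integral {R / 4..R / 2} (\<lambda>r. m / 4)"
      using R by simp
    also have "\<dots> \<le> integral {R / 4..R / 2} (\<lambda>r. (e r)\<^sup>2 * Q r)"
    proof (rule integral_le)
      fix r assume r: "r \<in> {R / 4..R / 2}"
      have "1 / 2 \<le> e r"
      proof -
        \<comment> \<open>The cutoff equals 1/2 at the geometric mean of \<open>a\<close> and
          \<open>R\<close>, so it is enough that r^2 \<ge> R a.\<close>
        have "ln (R * a) \<le> ln (r * r)"
        proof (intro ln_mono)
          have "R * a \<le> R * (R / 16)" using a R by (intro mult_left_mono) auto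
          also have "\<dots> = (R / 4) * (R / 4)" by simp
          also have "\<dots> \<le> r * r" using r R by (intro mult_mono) auto
          finally show "R * a \<le> r * r" .
        qed (use a r R in auto)
        then have "ln R + ln a \<le> 2 * ln r"
          using a r R by (simp add: ln_mult)
        then show ?thesis
          using L0 by (simp add: e_def lna field_simps)
      qed
      then have "(1 / 2)\<^sup>2 \<le> (e r)\<^sup>2" by (intro power_mono) auto
      then have "(1 / 2)\<^sup>2 * m \<le> (e r)\<^sup>2 * Q r"
        using m(1) m(2)[OF r] by (intro mult_mono) auto
      then show "m / 4 \<le> (e r)\<^sup>2 * Q r" by (simp add: power2_eq_square)
    qed (use int R in auto)
    also have "\<dots> \<le> integral {a..R} (\<lambda>r. (e r)\<^sup>2 * Q r)"
      using a R Qnn int by (intro integral_subset_le) auto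
    finally show ?thesis .
  qed
  have "m * R / 16 \<le> C / L"
    using upper lower by linarith
  then have "L * (m * R) \<le> 16 * C"
    using L0 by (simp add: field_simps)
  with L show False by simp
qed

section \<open>Growth of the singular solution\<close>

lemma standing_assumptionsD:
  assumes "standing_assumptions f"
  shows "(f has_real_derivative deriv f x) (at x)" and "continuous_on UNIV (deriv f)"
    and "continuous_on UNIV f" and "f 0 = 0"
    and "u > 0 \<Longrightarrow> f u > 0" and "u > 0 \<Longrightarrow> deriv f u > 0"
    and "u > 0 \<Longrightarrow> set_integrable lborel {u..} (\<lambda>s. 1 / f s)"
    and "0 < a \<Longrightarrow> a < b \<Longrightarrow> deriv f a < deriv f b"
    and "0 < a \<Longrightarrow> a \<le> b \<Longrightarrow> f a \<le> f b"
    and "0 \<le> a \<Longrightarrow> a < b \<Longrightarrow> f b - f a < deriv f b * (b - a)"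
proof -
  have C1: "f C1_differentiable_on UNIV" and C2: "deriv f C1_differentiable_on (- {0})"
    and odd: "\<And>x. f (- x) = - f x"
    and pos: "\<And>u. u > 0 \<Longrightarrow> f u > 0" "\<And>u. u > 0 \<Longrightarrow> deriv f u > 0"
      "\<And>u. u > 0 \<Longrightarrow> deriv (deriv f) u > 0"
    and int: "\<And>u. u > 0 \<Longrightarrow> set_integrable lborel {u..} (\<lambda>s. 1 / f s)"
    using assms by (auto simp: standing_assumptions_def C2_differentiable_on_def)
  show d: "(f has_real_derivative deriv f x) (at x)" for x
    using C1_differentiable_on_derivD(1)[OF C1] by simp
  show "continuous_on UNIV (deriv f)"
    using C1_differentiable_on_derivD(2)[OF C1] .
  show "continuous_on UNIV f"
    using C1 C1_differentiable_imp_continuous_on by blast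
  show "f 0 = 0"
    using odd[of 0] by simp
  show "u > 0 \<Longrightarrow> f u > 0" and "u > 0 \<Longrightarrow> deriv f u > 0"
    and "u > 0 \<Longrightarrow> set_integrable lborel {u..} (\<lambda>s. 1 / f s)"
    using pos int by auto
  show strict: "deriv f a < deriv f b" if "0 < a" "a < b" for a b
  proof (rule DERIV_pos_imp_increasing[OF that(2)])
    fix x assume "a \<le> x" "x \<le> b"
    then show "\<exists>y. (deriv f has_real_derivative y) (at x) \<and> y > 0"
      using C1_differentiable_on_derivD(1)[OF C2, of x] pos(3)[of x] that(1) by auto
  qed
  show "f a \<le> f b" if "0 < a" "a \<le> b"
  proof (rule DERIV_nonneg_imp_nondecreasing[OF that(2)])
    fix x assume "a \<le> x" "x \<le> b"
    then show "\<exists>y. (f has_real_derivative y) (at x) \<and> y \<ge> 0"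
      using d[of x] pos(2)[of x] that(1) by (intro exI[of _ "deriv f x"]) auto
  qed
  show "f b - f a < deriv f b * (b - a)" if ab: "0 \<le> a" "a < b"
  proof -
    \<comment> \<open>The intermediate point is positive even for a = 0, so strict monotonicity of
      f' on the positive half-line applies.\<close>
    obtain z where z: "a < z" "z < b" "f b - f a = (b - a) * deriv f z"
      using MVT2[OF ab(2), of f "deriv f"] d by blast
    have "(b - a) * deriv f z < (b - a) * deriv f b"
      using strict[of z b] z ab by (intro mult_strict_left_mono) auto
    with z show ?thesis by (simp add: mult.commute)
  qed
qed

lemma tail_integral_pos_derivative:
  assumes f: "standing_assumptions f" and u: "u > 0"
  shows "tail_integral f u > 0"
    and "(tail_integral f has_real_derivative - 1 / f u) (at u)"
proof -
  note F = standing_assumptionsD[OF f]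
  have gc: "continuous_on {0<..} (\<lambda>s. 1 / f s)"
    using F(5) by (intro continuous_intros continuous_on_subset[OF F(3)]) (auto simp: less_imp_neq[symmetric])
  have der: "(tail_integral f has_real_derivative - 1 / f u) (at u)" if u: "u > 0" for u
  proof -
    define a b where "a = u / 2" and "b = u + 1"
    have ab: "0 < a" "a < u" "u < b" using u by (auto simp: a_def b_def)
    \<comment> \<open>Near \<open>u\<close> the tail is a constant minus an integral over a compact
      interval, to which the fundamental theorem of calculus applies.\<close>
    have split: "tail_integral f x = tail_integral f a - integral {a..x} (\<lambda>s. 1 / f s)" if x: "a < x" for x
    proof -
      have int1: "set_integrable lborel {a..<x} (\<lambda>s. 1 / f s)"
        using F(7)[OF ab(1)] by (rule set_integrable_subset) auto
      have "(LBINT s:{a..<x} \<union> {x..}. 1 / f s) = (LBINT s:{a..<x}. 1 / f s) + (LBINT s:{x..}. 1 / f s)"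
        using ab x by (intro set_integral_Un int1 F(7)) auto
      moreover have "{a..<x} \<union> {x..} = {a..}" using x by auto
      moreover have "(LBINT s:{a..<x}. 1 / f s) = integral {a..<x} (\<lambda>s. 1 / f s)"
        by (rule set_borel_integral_eq_integral(2)[OF int1])
      moreover have "\<dots> = integral {a..x} (\<lambda>s. 1 / f s)"
      proof (rule integral_spike_set)
        have "negligible {x}" by simp
        then show "negligible {s \<in> {a..<x} - {a..x}. 1 / f s \<noteq> 0}"
          and "negligible {s \<in> {a..x} - {a..<x}. 1 / f s \<noteq> 0}"
          by (auto intro: negligible_subset)
      qed
      ultimately show ?thesis by (simp add: tail_integral_def)
    qed
    have "((\<lambda>x. integral {a..x} (\<lambda>s. 1 / f s)) has_real_derivative 1 / f u) (at u within {a..b})"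
      using ab by (intro integral_has_real_derivative continuous_on_subset[OF gc]) auto
    then have "((\<lambda>x. integral {a..x} (\<lambda>s. 1 / f s)) has_real_derivative 1 / f u) (at u)"
      using ab by (simp add: at_within_Icc_at)
    then have "((\<lambda>x. tail_integral f a - integral {a..x} (\<lambda>s. 1 / f s)) has_real_derivative - 1 / f u) (at u)"
      by (auto intro!: derivative_eq_intros)
    then show ?thesis
      by (rule has_field_derivative_transform_within_open[where S = "{a<..}"]) (use ab split in auto)
  qed
  show "(tail_integral f has_real_derivative - 1 / f u) (at u)"
    by (rule der[OF u])
  \<comment> \<open>Nonnegativity of the tail at u + 1 together with strict decrease gives
    positivity at u.\<close>
  have "tail_integral f (u + 1) < tail_integral f u"
  proof (rule DERIV_neg_imp_decreasing[of u "u + 1" "tail_integral f"])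
    fix x assume "u \<le> x" "x \<le> u + 1"
    then show "\<exists>y. (tail_integral f has_real_derivative y) (at x) \<and> y < 0"
      using der[of x] F(5)[of x] u by (intro exI[of _ "- 1 / f x"]) auto
  qed simp
  moreover have "tail_integral f (u + 1) \<ge> 0"
    unfolding tail_integral_def set_lebesgue_integral_def
  proof (rule integral_nonneg_AE, rule AE_I2)
    fix x :: real
    show "0 \<le> indicator {u + 1..} x *\<^sub>R (1 / f x)"
      using F(5)[of x] u by (auto split: split_indicator)
  qed
  ultimately show "tail_integral f u > 0" by simp
qed

text \<open>Blow-up at the origin rules out u' > 0 on a whole interval (0, e), so the flux is
  nonpositive at points arbitrarily close to 0; being nonincreasing, it stays so.\<close>

lemma singular_radial_solution_deriv_nonpos:
  assumes f: "standing_assumptions f" and N: "N \<ge> 2" and sing: "singular_radial_solution N f u"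
    and pos: "\<And>r. r > 0 \<Longrightarrow> u r > 0" and r: "r > 0"
  shows "deriv u r \<le> 0"
proof -
  note F = standing_assumptionsD[OF f]
  have ode: "radial_ode N f u" and top: "filterlim u at_top (at_right 0)"
    using sing by (auto simp: singular_radial_solution_def)
  note D = radial_odeD[OF ode]
  have small: "\<exists>s. 0 < s \<and> s < e \<and> deriv u s \<le> 0" if "e > 0" for e
  proof (rule ccontr)
    assume no: "\<not> ?thesis"
    have "eventually (\<lambda>s. u s > u (e / 2)) (at_right 0)"
      using top by (auto simp: filterlim_at_top_dense)
    moreover have "eventually (\<lambda>s. s \<in> {0<..<e / 2}) (at_right 0)"
      using that by (intro eventually_at_right_real) simp
    ultimately have "eventually (\<lambda>s. u s > u (e / 2) \<and> s \<in> {0<..<e / 2}) (at_right 0)"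
      by (rule eventually_conj)
    then obtain s where s: "u s > u (e / 2)" "0 < s" "s < e / 2"
      using eventually_happens trivial_limit_at_right_real by fastforce
    have "u s \<le> u (e / 2)"
    proof (rule DERIV_nonneg_imp_nondecreasing[of s "e / 2" u])
      fix x assume "s \<le> x" "x \<le> e / 2"
      then have x: "0 < x" "x < e" using s by auto
      then have "\<not> deriv u x \<le> 0" using no by blast
      then show "\<exists>y. (u has_real_derivative y) (at x) \<and> y \<ge> 0"
        using D(1)[OF x(1)] by (intro exI[of _ "deriv u x"]) auto
    qed (use s in simp)
    with s show False by simp
  qed
  have "r ^ (N - 1) * deriv u r \<le> 0"
  proof (rule nonincreasing_from_origin_nonpos[OF r radial_flux_derivative[OF ode N]])
    show "- (s ^ (N - 1) * f (u s)) \<le> 0" if "0 < s" "s \<le> r" for s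
      using F(5)[OF pos[OF that(1)]] that by simp
    show "\<exists>s>0. s < e \<and> s ^ (N - 1) * deriv u s \<le> e" if "e > 0" for e
    proof -
      obtain s where s: "0 < s" "s < e" "deriv u s \<le> 0"
        using small[of e] \<open>e > 0\<close> by auto
      then have "s ^ (N - 1) * deriv u s \<le> 0"
        by (simp add: mult_nonneg_nonpos)
      with s that show ?thesis by (intro exI[of _ s]) auto
    qed
  qed auto
  with zero_less_power[OF r, of "N - 1"] show ?thesis
    by (auto simp: mult_le_0_iff)
qed

text \<open>As u is nonincreasing, f(u(s)) \<ge> f(u(r)) for s \<le> r. Integrating the flux gives
  -u'(r) \<ge> r f(u(r)) / N. Hence F(u(r)), with derivative -u'/f(u), grows at rate at least r/N,
  and it is positive near 0.\<close>

lemma singular_radial_solution_tail_integral_ge: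
  assumes f: "standing_assumptions f" and N: "N \<ge> 2" and sing: "singular_radial_solution N f u"
    and pos: "\<And>r. r > 0 \<Longrightarrow> u r > 0" and r: "r > 0"
  shows "tail_integral f (u r) \<ge> r\<^sup>2 / (2 * real N)"
proof -
  note F = standing_assumptionsD[OF f]
  note T = tail_integral_pos_derivative[OF f]
  have ode: "radial_ode N f u"
    using sing by (simp add: singular_radial_solution_def)
  note D = radial_odeD[OF ode]
  have du: "deriv u r \<le> 0" if "r > 0" for r
    by (rule singular_radial_solution_deriv_nonpos[OF f N sing _ that]) (rule pos)
  have anti: "u r \<le> u s" if "0 < s" "s \<le> r" for r s
  proof (rule DERIV_nonpos_imp_nonincreasing[of s r u])
    show "\<exists>y. (u has_real_derivative y) (at t) \<and> y \<le> 0" if "s \<le> t" "t \<le> r" for t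
      using D(1)[of t] du[of t] that \<open>0 < s\<close> by auto
  qed (fact that)
  have slope: "- deriv u r / f (u r) \<ge> r / real N" if r: "r > 0" for r
  proof -
    define c where "c = f (u r) / real N"
    have c: "c > 0" "c * real N = f (u r)"
      using F(5)[OF pos[OF r]] N by (auto simp: c_def)
    \<comment> \<open>The nonlinearity is frozen at its value at \<open>r\<close>, its minimum over
      (0, r].\<close>
    define z where "z s = s ^ (N - 1) * deriv u s + c * s ^ N" for s
    have "z r \<le> 0"
    proof (rule nonincreasing_from_origin_nonpos[OF r])
      fix s assume s: "0 < s" "s \<le> r"
      have "((\<lambda>s. c * s ^ N) has_real_derivative c * (real N * s ^ (N - 1))) (at s)"
        by (auto intro!: derivative_eq_intros)
      from DERIV_add[OF radial_flux_derivative[OF ode N s(1)] this]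
      have "(z has_real_derivative - (s ^ (N - 1) * f (u s)) + c * (real N * s ^ (N - 1))) (at s)"
        by (simp add: z_def[abs_def])
      moreover have "- (s ^ (N - 1) * f (u s)) + c * (real N * s ^ (N - 1)) = s ^ (N - 1) * (c * real N - f (u s))"
        by (simp add: algebra_simps)
      ultimately show "(z has_real_derivative s ^ (N - 1) * (f (u r) - f (u s))) (at s)"
        by (simp add: c)
      show "s ^ (N - 1) * (f (u r) - f (u s)) \<le> 0"
        using F(9)[OF pos[OF r] anti[OF s]] s by (intro mult_nonneg_nonpos) auto
    next
      fix e :: real assume e: "e > 0"
      \<comment> \<open>With s \<le> 1 and s \<le> e/c one has c s^N \<le> c s \<le> e, and the flux
        part of \<open>z\<close> is nonpositive.\<close>
      define s where "s = min (e / 2) (min 1 (e / c))"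
      have s: "0 < s" "s < e" "s \<le> 1" "s \<le> e / c"
        using e c by (auto simp: s_def min_le_iff_disj min_less_iff_disj)
      have "s ^ N \<le> s"
        using power_decreasing[of 1 N s] s N by simp
      then have "c * s ^ N \<le> c * s"
        using c by simp
      also have "\<dots> \<le> e"
        using s c by (simp add: pos_le_divide_eq mult.commute)
      finally have "z s \<le> e"
        using du[OF s(1)] s(1) mult_nonneg_nonpos[of "s ^ (N - 1)" "deriv u s"] by (simp add: z_def)
      with s show "\<exists>s>0. s < e \<and> z s \<le> e" by blast
    qed
    moreover have "z r = r ^ (N - 1) * (deriv u r + c * r)"
    proof -
      have "r ^ N = r * r ^ (N - 1)"
        using N by (simp add: power_eq_if)
      then show ?thesis by (simp add: z_def algebra_simps)
    qed
    ultimately have "deriv u r + c * r \<le> 0"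
      using zero_less_power[OF r, of "N - 1"] by (auto simp: mult_le_0_iff)
    then have "f (u r) * r / real N \<le> - deriv u r"
      by (simp add: c_def)
    then show ?thesis
      using F(5)[OF pos[OF r]] by (subst pos_le_divide_eq) (auto simp: mult.commute)
  qed
  define z where "z s = s\<^sup>2 / (2 * real N) - tail_integral f (u s)" for s
  have "z r \<le> 0"
  proof (rule nonincreasing_from_origin_nonpos[OF r])
    fix s assume s: "0 < s" "s \<le> r"
    have "((\<lambda>s. tail_integral f (u s)) has_real_derivative - 1 / f (u s) * deriv u s) (at s)"
      by (rule DERIV_chain2[OF T(2)[OF pos[OF s(1)]] D(1)[OF s(1)]])
    then show "(z has_real_derivative s / real N - - deriv u s / f (u s)) (at s)"
      unfolding z_def using N by (auto intro!: derivative_eq_intros)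
    show "s / real N - - deriv u s / f (u s) \<le> 0"
      using slope[OF s(1)] by simp
  next
    fix e :: real assume e: "e > 0"
    define s where "s = min e 1 / 2"
    have s: "0 < s" "s < e" "s \<le> 1" using e by (auto simp: s_def)
    have "s\<^sup>2 / (2 * real N) \<le> s\<^sup>2 / 1"
      using N by (intro divide_left_mono) auto
    also have "\<dots> \<le> s" using s by (simp add: power2_eq_square mult_le_cancel_left1)
    finally have "z s \<le> e"
      using T(1)[OF pos[OF s(1)]] s by (simp add: z_def)
    with s show "\<exists>s>0. s < e \<and> z s \<le> e" by blast
  qed
  then show ?thesis by (simp add: z_def)
qed

text \<open>The derivative of A = f F^(s+1) is F^s (f' F - (s+1)), nonpositive by
  \<open>growth\<close>. Since F^(-s) has derivative s/A, it increases at least at the constant rate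
  s/A(u0), so K = A(u0) works.\<close>

lemma tail_integral_powr_ge:
  assumes f: "standing_assumptions f" and s: "s > 0" and u0: "u0 > 0"
    and growth: "\<And>v. v \<ge> u0 \<Longrightarrow> deriv f v * tail_integral f v \<le> s + 1"
  obtains K where "K > 0" "\<And>v. v \<ge> u0 \<Longrightarrow> tail_integral f v powr (- s) \<ge> s / K * (v - u0)"
proof -
  note F = standing_assumptionsD[OF f]
  note T = tail_integral_pos_derivative[OF f]
  define A where "A v = f v * tail_integral f v powr (s + 1)" for v
  have Apos: "A v > 0" if "v \<ge> u0" for v
    using F(5)[of v] T(1)[of v] that u0 by (simp add: A_def)
  have pd: "((\<lambda>v. tail_integral f v powr q) has_real_derivative
      q * tail_integral f v powr (q - 1) * (- 1 / f v)) (at v)" if "v \<ge> u0" for v q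
    using that u0 by (intro DERIV_chain2[OF has_real_derivative_powr T(2)] T(1)) auto
  have Ale: "A v \<le> A u0" if "v \<ge> u0" for v
  proof (rule DERIV_nonpos_imp_nonincreasing[of u0 v A])
    fix t assume t: "u0 \<le> t" "t \<le> v"
    let ?F = "tail_integral f t"
    have ft: "f t > 0" "?F > 0" using F(5)[of t] T(1)[of t] t u0 by auto
    have "(A has_real_derivative deriv f t * ?F powr (s + 1) + (s + 1) * ?F powr (s + 1 - 1) * (- 1 / f t) * f t) (at t)"
      unfolding A_def by (rule DERIV_mult[OF F(1) pd[OF t(1)]])
    moreover have "deriv f t * ?F powr (s + 1) + (s + 1) * ?F powr (s + 1 - 1) * (- 1 / f t) * f t
        = ?F powr s * (deriv f t * ?F - (s + 1))"
      using ft by (simp add: powr_add algebra_simps)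
    moreover have "\<dots> \<le> 0"
      using growth[OF t(1)] by (intro mult_nonneg_nonpos) auto
    ultimately show "\<exists>y. (A has_real_derivative y) (at t) \<and> y \<le> 0" by auto
  qed (fact that)
  show ?thesis
  proof
    show K: "A u0 > 0" by (rule Apos) simp
    fix v assume v: "v \<ge> u0"
    define z where "z v = tail_integral f v powr (- s) - s / A u0 * v" for v
    have "z u0 \<le> z v"
    proof (rule DERIV_nonneg_imp_nondecreasing[of u0 v z])
      fix t assume t: "u0 \<le> t" "t \<le> v"
      let ?F = "tail_integral f t"
      have ft: "f t > 0" "?F > 0" using F(5)[of t] T(1)[of t] t u0 by auto
      have "(z has_real_derivative (- s) * ?F powr (- s - 1) * (- 1 / f t) - s / A u0) (at t)"
        unfolding z_def by (rule DERIV_diff[OF pd[OF t(1)] DERIV_cmult_Id])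
      moreover have "(- s) * ?F powr (- s - 1) * (- 1 / f t) = s / A t"
      proof -
        have "- s - 1 = - (s + 1)" by simp
        then have "?F powr (- s - 1) = 1 / ?F powr (s + 1)"
          by (simp only: powr_minus_divide)
        then show ?thesis by (simp add: A_def)
      qed
      moreover have "s / A u0 \<le> s / A t"
        using Ale[OF t(1)] Apos[OF t(1)] s K by (intro divide_left_mono) auto
      ultimately show "\<exists>y. (z has_real_derivative y) (at t) \<and> y \<ge> 0" by auto
    qed (fact v)
    moreover have "tail_integral f u0 powr (- s) \<ge> 0" by simp
    ultimately show "tail_integral f v powr (- s) \<ge> s / A u0 * (v - u0)"
      unfolding z_def right_diff_distrib by linarith
  qed
qed

text \<open>The two estimates of F meet: F(u)^(-s) is at least linear in u, and at most A(r)^(-1)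
  because F(u(r)) \<ge> r^2/(2N). So A(r) u(r) is bounded, and its square is r^(N-2) u^2 up to a
  constant.\<close>

lemma singular_radial_solution_bound:
  assumes f: "standing_assumptions f" and N: "N \<ge> 3" and sing: "singular_radial_solution N f u"
    and pos: "\<And>r. r > 0 \<Longrightarrow> u r > 0"
    and growth: "eventually (\<lambda>v. deriv f v * tail_integral f v \<le> (real N + 2) / 4) at_top"
  obtains C where "\<And>r. 0 < r \<Longrightarrow> r < R \<Longrightarrow> r ^ (N - 2) * (u r)\<^sup>2 \<le> C"
proof -
  note T = tail_integral_pos_derivative[OF f]
  \<comment> \<open>Then s + 1 is the critical value (N+2)/4, and 4 s = N - 2 is the power of r
    obtained after squaring.\<close>
  define s where "s = (real N - 2) / 4"
  have s: "s > 0" "s + 1 = (real N + 2) / 4" using N by (auto simp: s_def field_simps)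
  obtain u1 where u1: "\<And>v. v \<ge> u1 \<Longrightarrow> deriv f v * tail_integral f v \<le> s + 1"
    using growth unfolding s eventually_at_top_linorder by auto
  define u0 where "u0 = max 1 u1"
  have u0: "u0 > 0" "\<And>v. v \<ge> u0 \<Longrightarrow> deriv f v * tail_integral f v \<le> s + 1"
    using u1 by (auto simp: u0_def)
  obtain K where K: "K > 0" "\<And>v. v \<ge> u0 \<Longrightarrow> tail_integral f v powr (- s) \<ge> s / K * (v - u0)"
    using tail_integral_powr_ge[OF f s(1) u0] by blast
  define A where "A r = (r\<^sup>2 / (2 * real N)) powr s" for r
  \<comment> \<open>The first summand comes from the linear lower bound, the second absorbs the
    shift by \<open>u0\<close> and the radii where u is below \<open>u0\<close>.\<close>
  define B where "B = K / s + u0 * A R"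
  define D where "D = (2 * real N) powr (2 * s)"
  show ?thesis
  proof
    fix r assume r: "0 < r" "r < R"
    have x: "r\<^sup>2 / (2 * real N) > 0" using r N by simp
    then have Apos: "A r > 0" using r N by (simp add: A_def)
    have AR: "A r \<le> A R"
      unfolding A_def using r s N by (intro powr_mono2 divide_right_mono power_mono) auto
    have "A r * u r \<le> B"
    proof (cases "u r \<ge> u0")
      case True
      have "A r \<le> tail_integral f (u r) powr s"
        unfolding A_def
      proof (rule powr_mono2)
        show "r\<^sup>2 / (2 * real N) \<le> tail_integral f (u r)"
          by (rule singular_radial_solution_tail_integral_ge[OF f _ sing _ r(1)]) (use N pos in auto)
      qed (use s in auto)
      then have "tail_integral f (u r) powr (- s) \<le> 1 / A r"
        using Apos T(1)[OF pos[OF r(1)]] by (simp add: powr_minus_divide divide_left_mono)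
      with K(2)[OF True] have "s / K * (u r - u0) \<le> 1 / A r" by simp
      then have "A r * (u r - u0) \<le> K / s"
        using Apos K s by (simp add: field_simps)
      moreover have "u0 * A r \<le> u0 * A R"
        using AR u0 by simp
      ultimately show ?thesis
        by (simp add: B_def algebra_simps)
    next
      case False
      then have "A r * u r \<le> A R * u0"
        using AR Apos pos[OF r(1)] by (intro mult_mono) auto
      also have "\<dots> \<le> B"
        using K s by (simp add: B_def mult.commute)
      finally show ?thesis .
    qed
    then have "(A r * u r)\<^sup>2 \<le> B\<^sup>2"
      using Apos pos[OF r(1)] by (intro power_mono) auto
    moreover have A2: "(A r)\<^sup>2 * D = r ^ (N - 2)"
    proof -
      have "(A r)\<^sup>2 = (r\<^sup>2 / (2 * real N)) powr (2 * s)"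
        using x by (simp add: A_def powr_add[symmetric] power2_eq_square)
      then have "(A r)\<^sup>2 * D = (r\<^sup>2) powr (2 * s)"
        using x r N by (simp add: D_def powr_mult[symmetric])
      also have "r\<^sup>2 = r powr 2"
        using r by (simp add: powr_numeral)
      also have "(r powr 2) powr (2 * s) = r powr real (N - 2)"
      proof -
        have "2 * (2 * s) = real (N - 2)"
          using N by (simp add: s_def of_nat_diff field_simps)
        then show ?thesis by (simp only: powr_powr)
      qed
      finally show ?thesis
        using r by (simp add: powr_realpow)
    qed
    moreover have "D \<ge> 0" by (simp add: D_def)
    ultimately show "r ^ (N - 2) * (u r)\<^sup>2 \<le> B\<^sup>2 * D"
      using mult_right_mono[of "(A r * u r)\<^sup>2" "B\<^sup>2" D] by (simp add: power_mult_distrib mult_ac flip: A2)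
  qed
qed

text \<open>Positivity near 0 confines the search to a compact interval \<open>{a..r1}\<close>, so a
  least point with m \<le> 0 exists.\<close>

lemma first_zero:
  fixes m :: "real \<Rightarrow> real"
  assumes cont: "continuous_on {0<..} m" and ev: "eventually (\<lambda>r. m r > 0) (at_right 0)"
    and r1: "r1 > 0" "m r1 \<le> 0"
  obtains R where "R > 0" "m R = 0" "\<And>r. 0 < r \<Longrightarrow> r < R \<Longrightarrow> m r > 0"
proof -
  obtain d where d: "d > 0" "\<And>r. 0 < r \<Longrightarrow> r < d \<Longrightarrow> m r > 0"
    using ev unfolding eventually_at_right_field by auto
  define a where "a = min (d / 2) r1"
  have a: "0 < a" "a < d" "a \<le> r1" using d r1 by (auto simp: a_def)
  have c: "continuous_on {a..r1} m"
    using a by (intro continuous_on_subset[OF cont]) auto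
  define S where "S = {a..r1} \<inter> m -` {..0}"
  have "closed S"
    unfolding S_def by (intro continuous_closed_preimage c) auto
  then have "compact S"
    by (simp add: S_def compact_eq_bounded_closed bounded_Int)
  moreover have "r1 \<in> S" using a r1 by (simp add: S_def)
  ultimately obtain R where R: "R \<in> S" "\<And>t. t \<in> S \<Longrightarrow> R \<le> t"
    using compact_attains_inf[of S] by auto
  have RS: "a \<le> R" "R \<le> r1" "m R \<le> 0" using R by (auto simp: S_def)
  \<comment> \<open>A zero below \<open>R\<close> belongs to \<open>S\<close>, so it coincides with
    the least point \<open>R\<close>.\<close>
  obtain x where x: "a \<le> x" "x \<le> R" "m x = 0"
    using IVT2'[of m R 0 a] d(2)[OF a(1,2)] RS continuous_on_subset[OF c, of "{a..R}"] by force
  then have "x \<in> S" using RS by (simp add: S_def)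
  with R x have "m R = 0" by force
  moreover have "m r > 0" if "0 < r" "r < R" for r
  proof (cases "r < d")
    case True
    with d that show ?thesis by auto
  next
    case False
    with R(2)[of r] that RS a show ?thesis by (force simp: S_def)
  qed
  ultimately show ?thesis
    using that[of R] RS a by auto
qed

section \<open>Stability and monotonicity\<close>

text \<open>The comparison is monotonicity of the integral, which requires both integrands to be
  integrable, since a non-integrable one would get the value 0. The origin is excluded in
  \<open>le\<close> because the singular potential has an arbitrary value there.\<close>

lemma nonneg_quadratic_form_mono:
  fixes V W :: "real ^ 'n::finite \<Rightarrow> real"
  assumes stab: "nonneg_quadratic_form V" and V: "V \<in> L1_loc" and W: "continuous_on UNIV W"
    and le: "\<And>x. x \<noteq> 0 \<Longrightarrow> W x \<le> V x"
  shows "nonneg_quadratic_form W"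
  unfolding nonneg_quadratic_form_def
proof
  fix \<phi> :: "real ^ 'n \<Rightarrow> real"
  assume \<phi>: "\<phi> \<in> C1_compact_support"
  define K where "K = closure {x. \<phi> x \<noteq> 0}"
  have K: "compact K" and diff: "\<And>x. \<phi> differentiable (at x)"
    and pc: "\<And>i. continuous_on UNIV (partial_derivative i \<phi>)"
    using \<phi> by (auto simp: C1_compact_support_def C1_function_def K_def)
  have \<phi>c: "continuous_on UNIV \<phi>"
    using diff by (intro continuous_at_imp_continuous_on ballI differentiable_imp_continuous_within) auto
  have gc: "continuous_on UNIV (gradient \<phi>)"
    unfolding gradient_def by (intro continuous_on_vec_lambda pc)
  have \<phi>0: "\<phi> x = 0" if "x \<notin> K" for x
    using that closure_subset by (force simp: K_def)
  have g0: "gradient \<phi> x = 0" if "x \<notin> K" for x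
  proof -
    have "(\<phi> has_derivative (\<lambda>_. 0)) (at x)"
      by (rule has_derivative_transform_within_open[of "\<lambda>_. 0" _ _ _ "- K"])
         (use that \<phi>0 K in \<open>auto simp: compact_imp_closed open_Compl\<close>)
    from partial_derivativeI[OF this] show ?thesis
      by (simp add: gradient_def vec_eq_iff)
  qed
  have "integrable lborel (\<lambda>x. indicator K x *\<^sub>R (norm (gradient \<phi> x))\<^sup>2)"
    by (intro borel_integrable_compact K continuous_intros continuous_on_subset[OF gc]) auto
  also have "(\<lambda>x. indicator K x *\<^sub>R (norm (gradient \<phi> x))\<^sup>2) = (\<lambda>x. (norm (gradient \<phi> x))\<^sup>2)"
    using g0 by (auto simp: fun_eq_iff split: split_indicator)
  finally have i1: "integrable lborel (\<lambda>x. (norm (gradient \<phi> x))\<^sup>2)" .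
  have "integrable lborel (\<lambda>x. indicator K x *\<^sub>R (W x * (\<phi> x)\<^sup>2))"
    by (intro borel_integrable_compact K continuous_intros continuous_on_subset[OF W] continuous_on_subset[OF \<phi>c]) auto
  also have "(\<lambda>x. indicator K x *\<^sub>R (W x * (\<phi> x)\<^sup>2)) = (\<lambda>x. W x * (\<phi> x)\<^sup>2)"
    using \<phi>0 by (auto simp: fun_eq_iff split: split_indicator)
  finally have iW: "integrable lborel (\<lambda>x. W x * (\<phi> x)\<^sup>2)" .
  \<comment> \<open>\<open>V\<close> is integrable on the support by local integrability, and the
    square of the test function is bounded there.\<close>
  have iV: "integrable lborel (\<lambda>x. V x * (\<phi> x)\<^sup>2)"
  proof -
    have VK: "integrable lborel (\<lambda>x. indicator K x *\<^sub>R V x)"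
      using V K by (simp add: L1_loc_def set_integrable_def)
    have eq: "(\<lambda>x. V x * (\<phi> x)\<^sup>2) = (\<lambda>x. (indicator K x *\<^sub>R V x) * (\<phi> x)\<^sup>2)"
      using \<phi>0 by (auto simp: fun_eq_iff split: split_indicator)
    have "compact ((\<lambda>x. (\<phi> x)\<^sup>2) ` K)"
      by (intro compact_continuous_image K continuous_intros continuous_on_subset[OF \<phi>c]) auto
    then obtain M where M: "\<And>x. x \<in> K \<Longrightarrow> \<bar>(\<phi> x)\<^sup>2\<bar> \<le> M"
      using compact_imp_bounded bounded_iff by (metis (no_types, lifting) imageI real_norm_def)
    show ?thesis
      unfolding eq
    proof (rule Bochner_Integration.integrable_bound[OF integrable_mult_right[OF VK, of M]])
      have "\<phi> \<in> borel_measurable borel"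
        using \<phi>c by (rule borel_measurable_continuous_onI)
      then show "(\<lambda>x. (indicator K x *\<^sub>R V x) * (\<phi> x)\<^sup>2) \<in> borel_measurable lborel"
        using VK by (intro borel_measurable_times borel_measurable_power) auto
      show "AE x in lborel. norm ((indicator K x *\<^sub>R V x) * (\<phi> x)\<^sup>2) \<le> norm (M * (indicator K x *\<^sub>R V x))"
      proof (rule AE_I2)
        fix x
        show "norm ((indicator K x *\<^sub>R V x) * (\<phi> x)\<^sup>2) \<le> norm (M * (indicator K x *\<^sub>R V x))"
        proof (cases "x \<in> K")
          case True
          then have "\<bar>(\<phi> x)\<^sup>2\<bar> \<le> \<bar>M\<bar>" using M[of x] by linarith
          then show ?thesis
            using True mult_left_mono[of "\<bar>(\<phi> x)\<^sup>2\<bar>" "\<bar>M\<bar>" "\<bar>V x\<bar>"] by (simp add: abs_mult mult_ac)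
        qed simp
      qed
    qed
  qed
  have "0 \<le> (LINT x|lborel. (norm (gradient \<phi> x))\<^sup>2 - V x * (\<phi> x)\<^sup>2)"
    using stab \<phi> by (simp add: nonneg_quadratic_form_def)
  also have "\<dots> \<le> (LINT x|lborel. (norm (gradient \<phi> x))\<^sup>2 - W x * (\<phi> x)\<^sup>2)"
  proof (rule integral_mono_AE)
    have "AE x in lborel. x \<noteq> (0 :: real ^ 'n)"
      by (rule AE_lborel_singleton)
    then show "AE x in lborel. (norm (gradient \<phi> x))\<^sup>2 - V x * (\<phi> x)\<^sup>2 \<le> (norm (gradient \<phi> x))\<^sup>2 - W x * (\<phi> x)\<^sup>2"
      by eventually_elim (auto intro!: mult_right_mono le)
  qed (intro Bochner_Integration.integrable_diff i1 iW iV)+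
  finally show "0 \<le> (LINT x|lborel. (norm (gradient \<phi> x))\<^sup>2 - W x * (\<phi> x)\<^sup>2)" .
qed

theorem theorem1p9:
  fixes f :: "real \<Rightarrow> real" and u :: "real \<Rightarrow> real \<Rightarrow> real" and ustar :: "real \<Rightarrow> real"
  assumes N: "CARD('n::finite) \<ge> 3"
    and f: "standing_assumptions f"
    and u: "\<And>\<alpha>. \<alpha> > 0 \<Longrightarrow> regular_radial_solution CARD('n) f \<alpha> (\<lambda>r. u r \<alpha>)"
    and growth: "eventually (\<lambda>v. deriv f v * tail_integral f v \<le> (real CARD('n) + 2) / 4) at_top"
    and sing: "singular_radial_solution CARD('n) f ustar"
    and pos: "\<And>r. r > 0 \<Longrightarrow> ustar r > 0"
    and loc: "(\<lambda>x :: real ^ 'n. deriv f (ustar (norm x))) \<in> L1_loc"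
    and stab: "nonneg_quadratic_form (\<lambda>x :: real ^ 'n. deriv f (ustar (norm x)))"
  shows "(\<forall>\<alpha>>0. stable_solution f (\<lambda>x :: real ^ 'n. u (norm x) \<alpha>)) \<and>
         (\<forall>r>0. strict_mono_on {0<..} (\<lambda>\<alpha>. u r \<alpha>))"
proof -
  let ?n = "CARD('n) - 1"
  note F = standing_assumptionsD[OF f]
  have N2: "CARD('n) \<ge> 2" using N by simp
  have odes: "radial_ode CARD('n) f ustar" and top: "filterlim ustar at_top (at_right 0)"
    using sing by (auto simp: singular_radial_solution_def)
  have ode: "radial_ode CARD('n) f (\<lambda>r. u r \<alpha>)" if "\<alpha> > 0" for \<alpha>
    using u[OF that] by (simp add: regular_radial_solution_def)
  have fc: "continuous_on {0<..} (\<lambda>r. f (v r))" if "radial_ode CARD('n) f v" for v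
    by (rule continuous_on_compose2[OF F(3) radial_odeD(3)[OF that]]) auto
  have Vc: "continuous_on {0<..} (\<lambda>r. deriv f (ustar r))"
    by (rule continuous_on_compose2[OF F(2) radial_odeD(3)[OF odes]]) auto
  have contra: False
    if "\<And>r. r > 0 \<Longrightarrow> (w has_real_derivative w' r) (at r)" "continuous_on {0<..} w'"
      "\<And>r. r > 0 \<Longrightarrow> ((\<lambda>r. r ^ ?n * w' r) has_real_derivative - (r ^ ?n * g r)) (at r)"
      "continuous_on {0<..} g" "R > 0" "w R = 0"
      and w: "\<And>r. 0 < r \<Longrightarrow> r < R \<Longrightarrow> 0 < w r" "\<And>r. 0 < r \<Longrightarrow> r < R \<Longrightarrow> w r \<le> ustar r"
      and g: "\<And>r. 0 < r \<Longrightarrow> r < R \<Longrightarrow> g r < deriv f (ustar r) * w r"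
    for w w' g :: "real \<Rightarrow> real" and R
  proof -
    obtain C where C: "\<And>r. 0 < r \<Longrightarrow> r < R \<Longrightarrow> r ^ (CARD('n) - 2) * (ustar r)\<^sup>2 \<le> C"
      using singular_radial_solution_bound[OF f N sing _ growth, of R] pos by blast
    show False
    proof (rule no_positive_strict_subsolution[OF stab Vc _ N2 that(1-6)])
      show "0 \<le> deriv f (ustar r)" if "r > 0" for r
        using F(6)[OF pos[OF that]] by simp
      show "r ^ (CARD('n) - 2) * (w r)\<^sup>2 \<le> C" if r: "0 < r" "r < R" for r
      proof -
        have "r ^ (CARD('n) - 2) * (w r)\<^sup>2 \<le> r ^ (CARD('n) - 2) * (ustar r)\<^sup>2"
          using w[OF r] r by (intro mult_left_mono power_mono) auto
        with C[OF r] show ?thesis by simp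
      qed
    qed (use w g in auto)
  qed
  have contra_diff: False
    if v: "radial_ode CARD('n) f v1" "radial_ode CARD('n) f v2" and R: "R > 0" "v1 R = v2 R"
      and less: "\<And>r. 0 < r \<Longrightarrow> r < R \<Longrightarrow> v2 r < v1 r"
      and pos2: "\<And>r. 0 < r \<Longrightarrow> r < R \<Longrightarrow> 0 < v2 r"
      and le: "\<And>r. 0 < r \<Longrightarrow> r < R \<Longrightarrow> v1 r \<le> ustar r"
    for v1 v2 R
  proof (rule contra[where w = "\<lambda>r. v1 r - v2 r" and w' = "\<lambda>r. deriv v1 r - deriv v2 r"
        and g = "\<lambda>r. f (v1 r) - f (v2 r)" and R = R])
    note D1 = radial_odeD[OF v(1)] and D2 = radial_odeD[OF v(2)]
    show "((\<lambda>r. v1 r - v2 r) has_real_derivative deriv v1 r - deriv v2 r) (at r)" if "r > 0" for r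
      by (rule DERIV_diff[OF D1(1)[OF that] D2(1)[OF that]])
    show "continuous_on {0<..} (\<lambda>r. deriv v1 r - deriv v2 r)"
      by (intro continuous_intros D1 D2)
    show "((\<lambda>r. r ^ ?n * (deriv v1 r - deriv v2 r)) has_real_derivative
        - (r ^ ?n * (f (v1 r) - f (v2 r)))) (at r)" if "r > 0" for r
      using DERIV_diff[OF radial_flux_derivative[OF v(1) N2 that] radial_flux_derivative[OF v(2) N2 that]]
      by (simp add: right_diff_distrib)
    show "continuous_on {0<..} (\<lambda>r. f (v1 r) - f (v2 r))"
      by (intro continuous_intros fc v)
    fix r assume r: "0 < r" "r < R"
    show "0 < v1 r - v2 r" "v1 r - v2 r \<le> ustar r"
      using less[OF r] pos2[OF r] le[OF r] by auto
    have "f (v1 r) - f (v2 r) < deriv f (v1 r) * (v1 r - v2 r)"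
      using less[OF r] pos2[OF r] by (intro F(10)) auto
    also have "\<dots> \<le> deriv f (ustar r) * (v1 r - v2 r)"
      using less[OF r] pos2[OF r] le[OF r] F(8)[of "v1 r" "ustar r"]
      by (intro mult_right_mono) (auto simp: order.order_iff_strict)
    finally show "f (v1 r) - f (v2 r) < deriv f (ustar r) * (v1 r - v2 r)" .
  qed (use R in auto)
  have origin: "((\<lambda>r. u r \<alpha>) \<longlongrightarrow> \<alpha>) (at_right 0)" if "\<alpha> > 0" for \<alpha>
  proof -
    have "((\<lambda>r. u r \<alpha>) has_real_derivative 0) (at 0 within {0..})" "u 0 \<alpha> = \<alpha>"
      using u[OF that] by (auto simp: regular_radial_solution_def)
    then have "((\<lambda>r. u r \<alpha>) \<longlongrightarrow> \<alpha>) (at 0 within {0..})"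
      using DERIV_continuous by (force simp: continuous_within)
    then show ?thesis by (rule tendsto_within_subset) auto
  qed
  have between: "0 < u r \<alpha> \<and> u r \<alpha> < ustar r" if \<alpha>: "\<alpha> > 0" and "r > 0" for \<alpha> r
  proof (rule ccontr)
    assume no: "\<not> ?thesis"
    \<comment> \<open>The minimum of the two gaps: its first zero is the first radius at which u
      vanishes or meets u*, and both inequalities hold strictly before it.\<close>
    define m where "m r = min (u r \<alpha>) (ustar r - u r \<alpha>)" for r
    have mc: "continuous_on {0<..} m"
      unfolding m_def by (intro continuous_intros radial_odeD(3)[OF ode[OF \<alpha>]] radial_odeD(3)[OF odes])
    have "eventually (\<lambda>r. u r \<alpha> > 0) (at_right 0)" "eventually (\<lambda>r. u r \<alpha> < \<alpha> + 1) (at_right 0)"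
      using order_tendstoD[OF origin[OF \<alpha>]] \<alpha> by auto
    moreover have "eventually (\<lambda>r. ustar r > \<alpha> + 1) (at_right 0)"
      using top by (auto simp: filterlim_at_top_dense)
    ultimately have "eventually (\<lambda>r. m r > 0) (at_right 0)"
      by eventually_elim (auto simp: m_def)
    moreover have "m r \<le> 0" using no by (auto simp: m_def min_le_iff_disj)
    ultimately obtain R where R: "R > 0" "m R = 0" and mpos: "\<And>r. 0 < r \<Longrightarrow> r < R \<Longrightarrow> m r > 0"
      using first_zero[OF mc _ \<open>r > 0\<close>] by blast
    from R(2) consider "u R \<alpha> = 0" | "ustar R = u R \<alpha>"
      by (auto simp: m_def min_def split: if_splits)
    then show False
    proof cases
      case 1
      note D = radial_odeD[OF ode[OF \<alpha>]]
      show False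
      \<comment> \<open>If u vanishes first, u itself is the subsolution: f(0) = 0 and strict
        convexity give f(u) < f'(u) u.\<close>
      proof (rule contra[where w = "\<lambda>r. u r \<alpha>" and w' = "deriv (\<lambda>r. u r \<alpha>)" and g = "\<lambda>r. f (u r \<alpha>)" and R = R])
        fix r assume r: "0 < r" "r < R"
        have b: "0 < u r \<alpha>" "u r \<alpha> < ustar r"
          using mpos[OF r] by (auto simp: m_def)
        show "0 < u r \<alpha>" "u r \<alpha> \<le> ustar r" using b by auto
        have "f (u r \<alpha>) < deriv f (u r \<alpha>) * u r \<alpha>"
          using F(10)[of 0 "u r \<alpha>"] b F(4) by simp
        also have "\<dots> < deriv f (ustar r) * u r \<alpha>"
          using F(8)[OF b] b by simp
        finally show "f (u r \<alpha>) < deriv f (ustar r) * u r \<alpha>" .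
      qed (use 1 R(1) D fc[OF ode[OF \<alpha>]] radial_flux_derivative[OF ode[OF \<alpha>] N2] in auto)
    next
      case 2
      show False
        by (rule contra_diff[OF odes ode[OF \<alpha>] R(1) 2]) (use mpos in \<open>auto simp: m_def\<close>)
    qed
  qed
  have less: "u r \<alpha> < u r \<beta>" if \<alpha>: "0 < \<alpha>" and "\<alpha> < \<beta>" and "r > 0" for \<alpha> \<beta> r
  proof (rule ccontr)
    assume "\<not> ?thesis"
    then have no: "u r \<beta> - u r \<alpha> \<le> 0" by simp
    have \<beta>: "\<beta> > 0" using that by simp
    have mc: "continuous_on {0<..} (\<lambda>r. u r \<beta> - u r \<alpha>)"
      by (intro continuous_intros radial_odeD(3)[OF ode[OF \<alpha>]] radial_odeD(3)[OF ode[OF \<beta>]])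
    have "eventually (\<lambda>r. u r \<beta> - u r \<alpha> > 0) (at_right 0)"
      using order_tendstoD(1)[OF tendsto_diff[OF origin[OF \<beta>] origin[OF \<alpha>]], of 0] that by simp
    from first_zero[OF mc this \<open>r > 0\<close> no] obtain R where R: "R > 0" "u R \<beta> - u R \<alpha> = 0"
      "\<And>r. 0 < r \<Longrightarrow> r < R \<Longrightarrow> u r \<beta> - u r \<alpha> > 0" by blast
    show False
      \<comment> \<open>Both regular solutions lie strictly between 0 and u*, so their first
        crossing falls under the same argument.\<close>
      by (rule contra_diff[OF ode[OF \<beta>] ode[OF \<alpha>] R(1)])
         (use R between[OF \<alpha>] between[OF \<beta>] in \<open>auto simp: less_imp_le\<close>)
  qed
  have "stable_solution f (\<lambda>x :: real ^ 'n. u (norm x) \<alpha>)" if \<alpha>: "\<alpha> > 0" for \<alpha>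
  proof -
    let ?w = "\<lambda>x :: real ^ 'n. u (norm x) \<alpha>"
    note lift = regular_radial_solution_lift[OF u[OF \<alpha>] N2 F(3)]
    have "continuous_on UNIV ?w"
      using lift(1) unfolding C2_function_def C1_function_def
      by (intro continuous_at_imp_continuous_on ballI differentiable_imp_continuous_within) auto
    then have "continuous_on UNIV (\<lambda>x. deriv f (?w x))"
      by (rule continuous_on_compose2[OF F(2)]) auto
    \<comment> \<open>Since 0 < u < u* and f' is increasing, the regular potential is dominated by
      the stable one away from the origin.\<close>
    then have "nonneg_quadratic_form (\<lambda>x. deriv f (?w x))"
    proof (rule nonneg_quadratic_form_mono[OF stab loc])
      fix x :: "real ^ 'n" assume "x \<noteq> 0"
      then show "deriv f (?w x) \<le> deriv f (ustar (norm x))"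
        using F(8)[of "?w x" "ustar (norm x)"] between[OF \<alpha>, of "norm x"] by simp
    qed
    with lift show ?thesis by (simp add: stable_solution_def)
  qed
  moreover have "strict_mono_on {0<..} (\<lambda>\<alpha>. u r \<alpha>)" if "r > 0" for r
    using less that by (intro strict_mono_onI) auto
  ultimately show ?thesis by blast
qed

end
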